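(* Suppose Assumptions AD and JK (stated in the context) hold, and assume $\mathcal V\cap\operatorname{null}(C)=\emptyset$, where $\mathcal V=\{v\in\mathbb R^m: v^\top A=0_R^\top,\ v^\top\iota_m=1\}$. Let $v^\ast$ be a minimiser of $v^\top Cv$ over $\mathcal V$. Let $q\ge1$ and let $u_1^\ast,\dots,u_q^\ast\in\mathbb R^m$ be such that, with $U^\ast=(u_1^\ast,\dots,u_q^\ast)$ (an $m\times q$ matrix), $$U^{\ast\top}A=0_{q\times R},\qquad U^{\ast\top}\iota_m=0_q,\qquad U^{\ast\top}CU^\ast=(v^{\ast\top}Cv^\ast)\,I_q.$$ Define $\tilde\varphi=v^{\ast\top}\hat{\boldsymbol\varphi}$, $\tilde\sigma_q^2=\frac1q\sum_{l=1}^q(u_l^{\ast\top}\hat{\boldsymbol\varphi})^2$ and $\tilde\sigma_q=\sqrt{\tilde\sigma_q^2}$. Then $$\mathcal J_q:=\frac{\tilde\varphi-\varphi}{\tilde\sigma_q}\xrightarrow{d}t_q$$ as $N,T\to\infty$ with $N/T\to\gamma^2\in(0,\infty)$, where $t_q$ is the Student $t$-distribution with $q$ degrees of freedom.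
   Context: Setting: panel data indexed by $i=1,\dots,N$, $t=1,\dots,T$; $\varphi$ is a scalar parameter of interest; $r_{NT}>0$ is a normalising sequence; all limits are as $N,T\to\infty$ with $N/T\to\gamma^2\in(0,\infty)$. $\iota_m$ is the $m$-vector of ones; $I_q$ the $q\times q$ identity. Assumption AD: there is an estimator $\hat\varphi^{(0)}$ of $\varphi$ with $r_{NT}(\hat\varphi^{(0)}-\varphi)=z_{NT}+\sum_{r=1}^R\mu_{r,NT}+o_p(1)$, where $\mu_{1,NT},\dots,\mu_{R,NT}$ are nonstochastic (possibly depending on $N,T$, not necessarily bounded) and $z_{NT}\xrightarrow{d}\mathcal N(0,\sigma^2)$ with $\sigma^2\in(0,\infty)$. Assumption JK: for a fixed integer $m\ge R+2$ there are estimators $\hat\varphi^{(1)},\dots,\hat\varphi^{(m-1)}$ (computed on subsamples) such that, with $\hat{\boldsymbol\varphi}=(\hat\varphi^{(0)},\dots,\hat\varphi^{(m-1)})^\top$ and $\boldsymbol\mu_{NT}=(\mu_{1,NT},\dots,\mu_{R,NT})^\top$, $$r_{NT}(\hat{\boldsymbol\varphi}-\varphi\iota_m)=\boldsymbol z_{NT}+A\boldsymbol\mu_{NT}+o_p(1),\qquad \boldsymbol z_{NT}\xrightarrow{d}\mathcal N(0_m,\sigma^2C),$$ where $A$ ($m\times R$) and $C$ ($m\times m$) are known nonrandom matrices with $\operatorname{rank}(A)=R$, $\iota_m\notin\operatorname{col}(A)$, $\operatorname{null}((A,\iota_m)^\top)\not\subseteq\operatorname{null}(C)$, and $C$ symmetric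 positive semidefinite. *)

theory Defs
  imports "HOL-Probability.Probability"
begin

definition op1 :: "'a measure \<Rightarrow> (nat \<Rightarrow> 'a \<Rightarrow> 'b::real_normed_vector) \<Rightarrow> bool" where
  "op1 M Y \<longleftrightarrow> (\<forall>e>0. (\<lambda>n. measure M {x \<in> space M. e \<le> norm (Y n x)}) \<longlonglongrightarrow> 0)"

definition conv_distr :: "'a measure \<Rightarrow> (nat \<Rightarrow> 'a \<Rightarrow> 'b::topological_space) \<Rightarrow> 'b measure \<Rightarrow> bool" where
  "conv_distr M X L \<longleftrightarrow>
     (\<forall>f :: 'b \<Rightarrow> real. continuous_on UNIV f \<and> bounded (range f) \<longrightarrow>
        (\<lambda>n. \<integral>x. f (X n x) \<partial>M) \<longlonglongrightarrow> (\<integral>x. f x \<partial>L))"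

(* L is the (possibly degenerate) centred multivariate normal law N(0, S), via its characteristic function *)
definition mvn_law :: "real^'m^'m \<Rightarrow> (real^'m) measure \<Rightarrow> bool" where
  "mvn_law S L \<longleftrightarrow> prob_space L \<and> sets L = sets borel \<and>
     (\<forall>t::real^'m. (CLINT x|L. iexp (t \<bullet> x)) = complex_of_real (exp (- (t \<bullet> (S *v t)) / 2)))"

definition t_density :: "nat \<Rightarrow> real \<Rightarrow> real" where
  "t_density q x = Gamma ((real q + 1) / 2) / (sqrt (real q * pi) * Gamma (real q / 2))
                   * (1 + x\<^sup>2 / real q) powr (- (real q + 1) / 2)"

definition student_t :: "nat \<Rightarrow> real measure" where
  "student_t q = density lborel (t_density q)"

end

theory Submission
  imports Defs
begin

text \<open>
  The weights annihilate \<open>A\<close>, so after multiplication by \<open>r\<close> the statistic is a ratio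
  \<open>g Y\<close> that is homogeneous of degree \<open>0\<close>, where \<open>Y\<close> differs from \<open>zJK\<close> by \<open>op1\<close>. Minimality of
  \<open>vs\<close> is the first-order condition \<open>u \<bullet> C vs = 0\<close> for every \<open>u\<close> orthogonal to \<open>A\<close> and to the ones
  vector. Hence under the limit law the numerator and the \<open>q\<close> terms of the denominator are
  independent centred normals of equal variance, and the ratio is Student distributed. The limit passes through
  \<open>g\<close> because its discontinuities lie where the denominator vanishes, a null set of the limit law.
\<close>

section \<open>Factorising characteristic functions\<close>

text \<open>The limit law is known only through its characteristic function, and \<open>C\<close>
  may be singular, so no joint density is at hand: independence has to be read off a factorised
  characteristic function, and densities enter only for the resulting standard normal coordinates.
  That no vector of \<V> is annihilated by \<open>C\<close> makes the common value \<open>c\<close>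
  of the quadratic forms positive; scaling by the square root of \<open>\<sigma>2 * c\<close>
  standardises numerator and denominator alike and cancels in the ratio. The bias
  \<open>\<mu>\<close> may be unbounded, so it is subtracted before any limit is taken, and the
  statistic equals \<open>g Y\<close> exactly for every index. The obstacle in the mapping step is
  the \<open>op1\<close> error: a bounded continuous test function need not be uniformly continuous,
  and tightness is not among the assumptions. The integrals of the cutoffs themselves converge, and
  this supplies the control of escaping mass.\<close>

lemma (in prob_space) integral_weight_indicator:
  fixes w X :: "'a \<Rightarrow> real"
  assumes [measurable]: "X \<in> borel_measurable M" and int_w: "integrable M w"
    and w_nonneg: "\<And>x. 0 \<le> w x"
    and char_eq: "\<And>s. (CLINT x|M. w x *\<^sub>R iexp (s * X x)) = (\<integral>x. w x \<partial>M) *\<^sub>R char (distr M borel X) s"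
    and [measurable]: "B \<in> sets borel"
  shows "(\<integral>x. w x * indicator B (X x) \<partial>M) = (\<integral>x. w x \<partial>M) * prob (X -` B \<inter> space M)"
proof -
  have [measurable]: "w \<in> borel_measurable M" using int_w by auto
  define c where "c = (\<integral>x. w x \<partial>M)"
  have c_nonneg: "c \<ge> 0" unfolding c_def using w_nonneg by (intro integral_nonneg_AE) auto
  show ?thesis
  proof (cases "c = 0")
    case True
    then have "AE x in M. w x = 0"
      unfolding c_def using integral_nonneg_eq_0_iff_AE[OF int_w] w_nonneg by auto
    then have "(\<integral>x. w x * indicator B (X x) \<partial>M) = 0"
      by (intro integral_eq_zero_AE) auto
    then show ?thesis using True c_def by simp
  next
    case False
    then have c: "c > 0" using c_nonneg by simp
    \<comment> \<open>Tilting by \<open>w\<close> gives a probability measure under which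
      \<open>X\<close> has the same characteristic function, by \<open>char_eq\<close>.
      One-dimensional uniqueness then gives \<open>X\<close> the same law under \<open>D\<close> and
      \<open>M\<close>, and undoing the density yields the claim.\<close>
    define D where "D = density M (\<lambda>x. ennreal (w x / c))"
    have D_sets [measurable_cong]: "sets D = sets M" by (simp add: D_def)
    have "emeasure D (space D) = (\<integral>\<^sup>+x. ennreal (w x / c) \<partial>M)"
      by (auto simp: D_def emeasure_density intro!: nn_integral_cong)
    also have "\<dots> = ennreal (\<integral>x. w x / c \<partial>M)"
      using w_nonneg c int_w by (intro nn_integral_eq_integral) auto
    also have "\<dots> = 1" using c by (simp add: c_def)
    finally interpret D: prob_space D by (rule prob_spaceI)
    have "char (distr D borel X) = char (distr M borel X)"
    proof
      fix s
      have "char (distr D borel X) s = (CLINT x|D. iexp (s * X x))"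
        by (simp add: char_def integral_distr)
      also have "\<dots> = (CLINT x|M. (w x / c) *\<^sub>R iexp (s * X x))"
        unfolding D_def using w_nonneg c by (subst integral_density) auto
      also have "\<dots> = (CLINT x|M. (1 / c) *\<^sub>R (w x *\<^sub>R iexp (s * X x)))"
        by (simp add: scaleR_conv_of_real)
      also have "\<dots> = char (distr M borel X) s"
        using c unfolding integral_scaleR_right char_eq by (simp add: c_def)
      finally show "char (distr D borel X) s = char (distr M borel X) s" .
    qed
    then have eq: "distr D borel X = distr M borel X"
      by (intro Levy_uniqueness D.real_distribution_distr real_distribution_distr) auto
    have "prob (X -` B \<inter> space M) = measure (distr M borel X) B"
      by (simp add: measure_distr)
    also have "\<dots> = (\<integral>x. indicator B (X x) \<partial>D)"
      unfolding eq[symmetric] by (subst integral_distr[symmetric, of X D borel]) auto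
    also have "\<dots> = (\<integral>x. (w x / c) *\<^sub>R indicator B (X x) \<partial>M)"
      unfolding D_def using w_nonneg c by (subst integral_density) auto
    finally show ?thesis using c by (simp add: c_def)
  qed
qed

text \<open>Tilting needs a nonnegative real weight. The real and imaginary parts of
  \<open>W\<close> are linear combinations of \<open>W\<close> and its conjugate, and conjugating
  \<open>char_eq\<close> at \<open>-s\<close> shows that the conjugate factorises too. The bound on
  \<open>W\<close> makes a shift by 1 enough for nonnegativity.\<close>

lemma (in prob_space) integral_complex_weight_indicator:
  fixes W :: "'a \<Rightarrow> complex" and X :: "'a \<Rightarrow> real"
  assumes [measurable]: "X \<in> borel_measurable M" "W \<in> borel_measurable M"
    and W_le: "\<And>x. norm (W x) \<le> 1"
    and char_eq: "\<And>s. (CLINT x|M. W x * iexp (s * X x)) = (CLINT x|M. W x) * char (distr M borel X) s"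
    and [measurable]: "B \<in> sets borel"
  shows "(CLINT x|M. indicator B (X x) * W x) = prob (X -` B \<inter> space M) * (CLINT x|M. W x)"
proof -
  let ?\<phi> = "char (distr M borel X)"
  have [measurable]: "(\<lambda>x. cnj (W x)) \<in> borel_measurable M"
    by (intro borel_measurable_continuous_on[where f = cnj] continuous_intros) auto
  have \<phi>_eq: "?\<phi> s = (CLINT x|M. iexp (s * X x))" for s
    by (simp add: char_def integral_distr)
  have int_W: "integrable M (\<lambda>x. W x * f x)" if [measurable]: "f \<in> borel_measurable M" and "\<And>x. norm (f x) \<le> 1"
    for f :: "'a \<Rightarrow> complex"
    using W_le that(2) by (intro integrable_const_bound[where B = 1]) (auto simp: norm_mult intro!: mult_le_one)
  have int_W1: "integrable M W" using int_W[of "\<lambda>_. 1"] by simp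
  have cnj_char: "cnj (?\<phi> (-s)) = ?\<phi> s" for s
    unfolding \<phi>_eq Bochner_Integration.integral_cnj[symmetric] by (simp add: exp_cnj del: Bochner_Integration.integral_cnj)
  have char_cnj: "(CLINT x|M. cnj (W x) * iexp (s * X x)) = cnj (CLINT x|M. W x) * ?\<phi> s" for s
  proof -
    have "(CLINT x|M. cnj (W x) * iexp (s * X x)) = cnj (CLINT x|M. W x * iexp (- s * X x))"
      unfolding Bochner_Integration.integral_cnj[symmetric] by (simp add: exp_cnj del: Bochner_Integration.integral_cnj)
    then show ?thesis unfolding char_eq by (simp add: cnj_char)
  qed
  have int_cW: "integrable M (\<lambda>x. cnj (W x) * f x)" if [measurable]: "f \<in> borel_measurable M" and "\<And>x. norm (f x) \<le> 1"
    for f :: "'a \<Rightarrow> complex"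
    using W_le that(2) by (intro integrable_const_bound[where B = 1]) (auto simp: norm_mult intro!: mult_le_one)
  have int_e: "integrable M (\<lambda>x. iexp (s * X x))" for s
    by (intro integrable_const_bound[where B = 1]) auto
  have main: "(\<integral>x. indicator B (X x) * g x \<partial>M) = prob (X -` B \<inter> space M) * (\<integral>x. g x \<partial>M)"
    if g: "\<And>x. complex_of_real (g x) = \<alpha> * W x + \<beta> * cnj (W x)" and [measurable]: "g \<in> borel_measurable M"
      and g_le: "\<And>x. \<bar>g x\<bar> \<le> 1" for g :: "'a \<Rightarrow> real" and \<alpha> \<beta>
  proof -
    have int_g: "integrable M g" using g_le by (intro integrable_const_bound[where B = 1]) auto
    have gE: "(CLINT x|M. g x * iexp (s * X x)) = (\<integral>x. g x \<partial>M) * ?\<phi> s" for s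
    proof -
      have e: "(CLINT x|M. g x * iexp (s * X x)) = \<alpha> * (CLINT x|M. W x * iexp (s * X x)) + \<beta> * (CLINT x|M. cnj (W x) * iexp (s * X x))"
        unfolding g ring_distribs using int_W int_cW by (simp add: mult.assoc)
      have "complex_of_real (\<integral>x. g x \<partial>M) = \<alpha> * (CLINT x|M. W x) + \<beta> * cnj (CLINT x|M. W x)"
        unfolding integral_complex_of_real[symmetric] g using int_W1 by simp
      then show ?thesis unfolding e char_eq char_cnj by (simp add: algebra_simps)
    qed
    \<comment> \<open>Adding \<open>1\<close>, which satisfies the same identity, makes the weight nonnegative.\<close>
    have "(\<integral>x. (1 + g x) * indicator B (X x) \<partial>M) = (\<integral>x. 1 + g x \<partial>M) * prob (X -` B \<inter> space M)"
    proof (rule integral_weight_indicator)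
      show "0 \<le> 1 + g x" for x using g_le[of x] by linarith
      fix s
      have ig: "integrable M (\<lambda>x. g x * iexp (s * X x))"
        using g_le by (intro integrable_const_bound[where B = 1]) (auto simp: norm_mult)
      have "(CLINT x|M. (1 + g x) *\<^sub>R iexp (s * X x)) = (CLINT x|M. iexp (s * X x) + g x * iexp (s * X x))"
        by (simp add: scaleR_conv_of_real algebra_simps)
      also have "\<dots> = (\<integral>x. 1 + g x \<partial>M) *\<^sub>R ?\<phi> s"
        using int_g unfolding Bochner_Integration.integral_add[OF int_e ig] gE \<phi>_eq[symmetric]
        by (simp add: prob_space scaleR_conv_of_real algebra_simps)
      finally show "(CLINT x|M. (1 + g x) *\<^sub>R iexp (s * X x)) = (\<integral>x. 1 + g x \<partial>M) *\<^sub>R ?\<phi> s" .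
    qed (use int_g in auto)
    moreover have "(\<integral>x. (1 + g x) * indicator B (X x) \<partial>M) = (\<integral>x. indicator B (X x) \<partial>M) + (\<integral>x. indicator B (X x) * g x \<partial>M)"
    proof -
      have "integrable M (\<lambda>x. indicator B (X x) * g x)" "integrable M (\<lambda>x. indicator B (X x) :: real)"
        using g_le by (intro integrable_const_bound[where B = 1], auto simp: indicator_def)+
      then show ?thesis by (simp add: algebra_simps)
    qed
    moreover have "(\<integral>x. indicator B (X x) \<partial>M) = prob (X -` B \<inter> space M)"
      by (subst integral_distr[symmetric, of X M borel]) (auto simp: measure_distr)
    ultimately show ?thesis using int_g by (simp add: prob_space algebra_simps)
  qed
  have Re: "(\<integral>x. indicator B (X x) * Re (W x) \<partial>M) = prob (X -` B \<inter> space M) * (\<integral>x. Re (W x) \<partial>M)"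
    by (rule main[of "\<lambda>x. Re (W x)" "1/2" "1/2"])
       (use W_le abs_Re_le_cmod order_trans in \<open>auto simp: complex_eq_iff, blast\<close>)
  have Im: "(\<integral>x. indicator B (X x) * Im (W x) \<partial>M) = prob (X -` B \<inter> space M) * (\<integral>x. Im (W x) \<partial>M)"
    by (rule main[of "\<lambda>x. Im (W x)" "-\<i>/2" "\<i>/2"])
       (use W_le abs_Im_le_cmod order_trans in \<open>auto simp: complex_eq_iff, blast\<close>)
  have ind: "Re (indicator B y) = indicator B y" "Im (indicator B y) = 0" for y
    by (auto simp: indicator_def)
  have "integrable M (\<lambda>x. indicator B (X x) * W x)"
    using W_le by (intro integrable_const_bound[where B = 1]) (auto simp: indicator_def)
  from integral_Re[OF this, symmetric] integral_Im[OF this, symmetric]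
    integral_Re[OF int_W1, symmetric] integral_Im[OF int_W1, symmetric]
  show ?thesis using Re Im by (simp add: complex_eq_iff ind)
qed

text \<open>
  Kac's theorem, from one-dimensional uniqueness only: the factors \<open>iexp (t i * X i)\<close> are replaced
  one by one by indicators of events \<open>X i \<in> B i\<close>.
\<close>

lemma (in prob_space) distr_PiM_eq_of_char_prod:
  fixes X :: "'i \<Rightarrow> 'a \<Rightarrow> real"
  assumes I: "finite I" and [measurable]: "\<And>i. X i \<in> borel_measurable M"
    and char_eq: "\<And>t. (CLINT x|M. iexp (\<Sum>i\<in>I. t i * X i x)) = (\<Prod>i\<in>I. char (distr M borel (X i)) (t i))"
  shows "distr M (PiM I (\<lambda>_. borel)) (\<lambda>x. \<lambda>i\<in>I. X i x) = PiM I (\<lambda>i. distr M borel (X i))"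
proof -
  let ?\<phi> = "\<lambda>i. char (distr M borel (X i))"
  interpret X: prob_space "distr M borel (X i)" for i by (rule prob_space_distr) simp
  interpret P: product_sigma_finite "\<lambda>i. distr M borel (X i)" ..
  \<comment> \<open>\<open>J\<close> collects the coordinates already turned into indicators. The
    frequencies \<open>t\<close> stay arbitrary in the induction because treating \<open>j\<close>
    needs the hypothesis at \<open>t(j := s)\<close> for every \<open>s\<close>: this is the
    factorisation that the one-dimensional lemma asks of the remaining factors
    \<open>W\<close>.\<close>
  have step: "(CLINT x|M. (\<Prod>i\<in>J. indicator (B i) (X i x)) * iexp (\<Sum>i\<in>I - J. t i * X i x))
        = (\<Prod>i\<in>J. complex_of_real (prob (X i -` B i \<inter> space M))) * (\<Prod>i\<in>I - J. ?\<phi> i (t i))"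
    if "finite J" "J \<subseteq> I" and B: "\<And>i. i \<in> I \<Longrightarrow> B i \<in> sets borel" for J B t
    using that(1,2)
  proof (induction J arbitrary: t)
    case empty
    then show ?case using char_eq by simp
  next
    case (insert j J)
    define K where "K = I - insert j J"
    have K: "I - J = insert j K" "j \<notin> K" "finite K" using insert I by (auto simp: K_def)
    have [measurable]: "B i \<in> sets borel" if "i \<in> J" for i using that insert B by auto
    have [measurable]: "B j \<in> sets borel" using insert B by auto
    define W where "W x = (\<Prod>i\<in>J. indicator (B i) (X i x)) * iexp (\<Sum>i\<in>K. t i * X i x)" for x
    have W_meas [measurable]: "W \<in> borel_measurable M" unfolding W_def by measurable
    let ?c = "(\<Prod>i\<in>J. complex_of_real (prob (X i -` B i \<inter> space M))) * (\<Prod>i\<in>K. ?\<phi> i (t i))"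
    have Ws: "(CLINT x|M. W x * iexp (s * X j x)) = ?c * ?\<phi> j s" for s
    proof -
      have "(CLINT x|M. W x * iexp (s * X j x))
         = (CLINT x|M. (\<Prod>i\<in>J. indicator (B i) (X i x)) * iexp (\<Sum>i\<in>I - J. (t(j := s)) i * X i x))"
      proof (intro Bochner_Integration.integral_cong refl)
        fix x
        have "(\<Sum>i\<in>I - J. (t(j := s)) i * X i x) = s * X j x + (\<Sum>i\<in>K. t i * X i x)"
          using K by (auto simp: intro!: sum.cong)
        then show "W x * iexp (s * X j x) = (\<Prod>i\<in>J. indicator (B i) (X i x)) * iexp (\<Sum>i\<in>I - J. (t(j := s)) i * X i x)"
          by (simp add: W_def exp_add algebra_simps)
      qed
      also have "\<dots> = (\<Prod>i\<in>J. complex_of_real (prob (X i -` B i \<inter> space M))) * (\<Prod>i\<in>I - J. ?\<phi> i ((t(j := s)) i))"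
        using insert by (intro insert.IH) auto
      also have "(\<Prod>i\<in>I - J. ?\<phi> i ((t(j := s)) i)) = ?\<phi> j s * (\<Prod>i\<in>K. ?\<phi> i (t i))"
        using K by (auto intro!: prod.cong)
      finally show ?thesis by (simp add: algebra_simps)
    qed
    have W0: "(CLINT x|M. W x) = ?c" using Ws[of 0] X.prob_space by (simp add: char_def)
    have "norm (W x) \<le> 1" for x
    proof -
      have "norm (W x) = (\<Prod>i\<in>J. norm (indicator (B i) (X i x) :: complex))"
        by (simp add: W_def norm_mult prod_norm)
      also have "\<dots> \<le> 1" by (intro prod_le_1) (auto simp: indicator_def)
      finally show ?thesis .
    qed
    then have "(CLINT x|M. indicator (B j) (X j x) * W x) = prob (X j -` B j \<inter> space M) * (CLINT x|M. W x)"
      by (intro integral_complex_weight_indicator) (simp_all only: Ws W0 W_meas assms(2) \<open>B j \<in> sets borel\<close>)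
    then show ?case
      unfolding W0 using insert by (simp add: W_def K_def mult_ac)
  qed
  show ?thesis
  proof (rule P.PiM_eqI[OF I])
    show "sets (distr M (Pi\<^sub>M I (\<lambda>_. borel)) (\<lambda>x. \<lambda>i\<in>I. X i x)) = sets (PiM I (\<lambda>i. distr M borel (X i)))"
      by (auto intro!: sets_PiM_cong)
  next
    fix B assume "\<And>i. i \<in> I \<Longrightarrow> B i \<in> sets (distr M borel (X i))"
    then have B: "\<And>i. i \<in> I \<Longrightarrow> B i \<in> sets borel" by simp
    have [measurable]: "Pi\<^sub>E I B \<in> sets (PiM I (\<lambda>_. borel))"
      using B I by (intro sets_PiM_I_finite) auto
    let ?E = "(\<lambda>x. \<lambda>i\<in>I. X i x) -` Pi\<^sub>E I B \<inter> space M"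
    have E: "?E \<in> sets M" by measurable
    have ind: "indicator ?E x = (\<Prod>i\<in>I. indicator (B i) (X i x) :: complex)" if "x \<in> space M" for x
      using that I by (auto simp: indicator_def PiE_iff)
    have "(CLINT x|M. indicator ?E x) = (CLINT x|M. complex_of_real (indicator ?E x))"
      by (intro Bochner_Integration.integral_cong) (auto simp: indicator_def)
    also have "\<dots> = complex_of_real (prob ?E)"
      unfolding integral_complex_of_real using E by simp
    finally have "complex_of_real (prob ?E) = (CLINT x|M. indicator ?E x)" ..
    also have "\<dots> = (CLINT x|M. (\<Prod>i\<in>I. indicator (B i) (X i x)))"
      by (intro Bochner_Integration.integral_cong refl ind)
    also have "\<dots> = complex_of_real (\<Prod>i\<in>I. prob (X i -` B i \<inter> space M))"
      using step[OF I subset_refl B] by simp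
    finally have "prob ?E = (\<Prod>i\<in>I. prob (X i -` B i \<inter> space M))" by (simp only: of_real_eq_iff)
    then show "emeasure (distr M (Pi\<^sub>M I (\<lambda>_. borel)) (\<lambda>x. \<lambda>i\<in>I. X i x)) (Pi\<^sub>E I B) =
        (\<Prod>i\<in>I. emeasure (distr M borel (X i)) (B i))"
      using B by (simp add: emeasure_distr emeasure_eq_measure prod_ennreal)
  qed
qed

section \<open>Student's ratio of independent normals\<close>

definition chi_square_density :: "real \<Rightarrow> real \<Rightarrow> real" where
  "chi_square_density d s =
     (if 0 < s then s powr (d / 2 - 1) * exp (- s / 2) / (2 powr (d / 2) * Gamma (d / 2)) else 0)"

lemma chi_square_density_measurable [measurable]: "chi_square_density d \<in> borel_measurable borel"
  unfolding chi_square_density_def[abs_def] by measurable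

lemma chi_square_density_nonneg: "0 < d \<Longrightarrow> 0 \<le> chi_square_density d s"
  by (auto simp: chi_square_density_def intro!: divide_nonneg_nonneg mult_nonneg_nonneg less_imp_le[OF Gamma_real_pos])

lemma nn_integral_even:
  fixes f :: "real \<Rightarrow> ennreal"
  assumes [measurable]: "f \<in> borel_measurable borel" and even: "\<And>x. f (- x) = f x"
  shows "(\<integral>\<^sup>+x. f x \<partial>lborel) = 2 * (\<integral>\<^sup>+x. f x * indicator {0..} x \<partial>lborel)"
proof -
  have "(\<integral>\<^sup>+x. f x \<partial>lborel) = (\<integral>\<^sup>+x. f x * indicator {0..} x + f x * indicator {..<0} x \<partial>lborel)"
    by (intro nn_integral_cong) (auto simp: indicator_def)
  also have "\<dots> = (\<integral>\<^sup>+x. f x * indicator {0..} x \<partial>lborel) + (\<integral>\<^sup>+x. f x * indicator {..<0} x \<partial>lborel)"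
    by (intro nn_integral_add) auto
  also have "(\<integral>\<^sup>+x. f x * indicator {..<0} x \<partial>lborel) = (\<integral>\<^sup>+x. f x * indicator {..<0} (- x) \<partial>lborel)"
    by (subst nn_integral_real_affine[where c = "-1" and t = 0]) (auto simp: even)
  also have "\<dots> = (\<integral>\<^sup>+x. f x * indicator {0..} x \<partial>lborel)"
    using AE_lborel_singleton[of "0::real"]
    by (intro nn_integral_cong_AE) (auto simp: indicator_def)
  finally show ?thesis by (simp add: mult_2)
qed

text \<open>The substitution is made on the compact interval from 0 to \<open>n\<close>, which
  squaring maps onto that from 0 to the square of \<open>n\<close>; monotone convergence in
  \<open>n\<close> reaches the half-line.\<close>

lemma nn_integral_square_substitution:
  fixes f :: "real \<Rightarrow> ennreal"
  assumes [measurable]: "f \<in> borel_measurable borel"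
  shows "(\<integral>\<^sup>+s. f s * indicator {0..} s \<partial>lborel) = (\<integral>\<^sup>+x. f (x\<^sup>2) * ennreal (2 * x) * indicator {0..} x \<partial>lborel)"
proof -
  have lim: "(\<integral>\<^sup>+x. g x * indicator {0..} x \<partial>lborel) = (SUP n. \<integral>\<^sup>+x. g x * indicator {0..b n} x \<partial>lborel)"
    if [measurable]: "g \<in> borel_measurable borel" and b: "mono b" "filterlim b at_top sequentially"
    for g :: "real \<Rightarrow> ennreal" and b :: "nat \<Rightarrow> real"
  proof -
    have sup: "(SUP n. g x * indicator {0..b n} x) = g x * indicator {0..} x" for x
    proof (rule antisym)
      show "(SUP n. g x * indicator {0..b n} x) \<le> g x * indicator {0..} x"
        by (intro SUP_least) (auto simp: indicator_def)
      obtain n where "x \<le> b n"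
        using b(2) by (auto simp: filterlim_at_top eventually_sequentially)
      then show "g x * indicator {0..} x \<le> (SUP n. g x * indicator {0..b n} x)"
        by (intro SUP_upper2[of n]) (auto simp: indicator_def)
    qed
    show ?thesis unfolding sup[symmetric]
      by (intro nn_integral_monotone_convergence_SUP)
         (auto simp: incseq_def le_fun_def indicator_def intro!: monoD[OF b(1)] dest: order_trans[OF _ monoD[OF b(1)]])
  qed
  have fl: "filterlim (\<lambda>n. real n ^ 2) at_top sequentially"
    by (intro filterlim_pow_at_top filterlim_real_sequentially) auto
  have eq: "(\<integral>\<^sup>+s. f s * indicator {0..(real n)\<^sup>2} s \<partial>lborel) = (\<integral>\<^sup>+x. f (x\<^sup>2) * ennreal (2 * x) * indicator {0..real n} x \<partial>lborel)" for n
  \<comment> \<open>Substitution is used on nondegenerate intervals only; for \<open>n = 0\<close>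
    both integrals run over a single point.\<close>
  proof (cases "n = 0")
    case True
    have "(\<integral>\<^sup>+x. g x * indicator {0} x \<partial>lborel) = 0" for g :: "real \<Rightarrow> ennreal"
      using AE_lborel_singleton[of "0::real"] by (intro nn_integral_zero') (auto elim!: eventually_mono)
    then show ?thesis using True by simp
  next
    case False
    have "((\<lambda>x. x\<^sup>2) has_real_derivative 2 * x) (at x)" for x :: real
      by (auto intro!: derivative_eq_intros)
    with False show ?thesis
      using nn_integral_substitution_aux[of f 0 "real n" "\<lambda>x. x\<^sup>2" "\<lambda>x. 2 * x"]
      by (auto intro!: continuous_intros)
  qed
  show ?thesis
    using lim[of f "\<lambda>n. (real n)\<^sup>2"] lim[of "\<lambda>x. f (x\<^sup>2) * ennreal (2 * x)" real] fl
    by (simp add: eq mono_def filterlim_real_sequentially)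
qed

text \<open>Evenness folds the normal density onto the half-line, and the resulting factor 2 meets
  the Jacobian \<open>2 * x\<close>; the constants agree because Gamma(1/2) is the square root of
  pi. Phrasing the law through a test function \<open>h\<close> lets it be iterated by
  Fubini.\<close>

lemma nn_integral_std_normal_square:
  fixes h :: "real \<Rightarrow> ennreal"
  assumes [measurable]: "h \<in> borel_measurable borel"
  shows "(\<integral>\<^sup>+x. h (x\<^sup>2) \<partial>std_normal_distribution) = (\<integral>\<^sup>+s. chi_square_density 1 s * h s \<partial>lborel)"
proof -
  have dens: "chi_square_density 1 (x\<^sup>2) * (2 * x) = 2 * std_normal_density x" if "x > 0" for x
    using that
    by (simp add: chi_square_density_def std_normal_density_def Gamma_one_half_real powr_half_sqrt
        powr_minus real_sqrt_mult field_simps)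
  have "(\<integral>\<^sup>+x. h (x\<^sup>2) \<partial>std_normal_distribution) = (\<integral>\<^sup>+x. std_normal_density x * h (x\<^sup>2) \<partial>lborel)"
    by (subst nn_integral_density) auto
  also have "\<dots> = 2 * (\<integral>\<^sup>+x. std_normal_density x * h (x\<^sup>2) * indicator {0..} x \<partial>lborel)"
    by (intro nn_integral_even) (auto simp: std_normal_density_def)
  also have "\<dots> = (\<integral>\<^sup>+x. 2 * (std_normal_density x * h (x\<^sup>2) * indicator {0..} x) \<partial>lborel)"
    by (subst nn_integral_cmult) auto
  also have "\<dots> = (\<integral>\<^sup>+x. (chi_square_density 1 (x\<^sup>2) * h (x\<^sup>2)) * ennreal (2 * x) * indicator {0..} x \<partial>lborel)"
  \<comment> \<open>The origin must be left out: there \<open>chi_square_density\<close> is 0 by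
    definition while the normal density is positive.\<close>
  proof (intro nn_integral_cong_AE eventually_mono[OF AE_lborel_singleton[of "0::real"]])
    fix x :: real assume "x \<noteq> 0"
    show "2 * (ennreal (std_normal_density x) * h (x\<^sup>2) * indicator {0..} x) =
       ennreal (chi_square_density 1 (x\<^sup>2)) * h (x\<^sup>2) * ennreal (2 * x) * indicator {0..} x"
    proof (cases "x > 0")
      case True
      then have "ennreal (chi_square_density 1 (x\<^sup>2)) * ennreal (2 * x) = 2 * ennreal (std_normal_density x)"
        using dens[OF True] chi_square_density_nonneg[of 1 "x\<^sup>2"]
        by (simp add: ennreal_mult[symmetric] flip: ennreal_numeral)
      then show ?thesis using True by (simp add: mult_ac) (metis mult.assoc mult.commute)
    qed (use \<open>x \<noteq> 0\<close> in auto)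
  qed
  also have "\<dots> = (\<integral>\<^sup>+s. chi_square_density 1 s * h s * indicator {0..} s \<partial>lborel)"
    by (subst nn_integral_square_substitution[where f = "\<lambda>s. chi_square_density 1 s * h s"]) auto
  also have "\<dots> = (\<integral>\<^sup>+s. chi_square_density 1 s * h s \<partial>lborel)"
    by (intro nn_integral_cong) (auto simp: indicator_def chi_square_density_def)
  finally show ?thesis .
qed

text \<open>Substituting \<open>s = w * t\<close> pulls out all powers of \<open>w\<close> and
  leaves Euler's Beta integral over the unit interval. Its value, a quotient of Gamma values, trades
  the two normalising constants for that of \<open>a + b\<close>.\<close>

lemma chi_square_density_convolution:
  assumes "0 < a" "0 < b"
  shows "(\<integral>\<^sup>+s. ennreal (chi_square_density a s) * ennreal (chi_square_density b (w - s)) \<partial>lborel) = chi_square_density (a + b) w"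
proof (cases "w > 0")
  case False
  then have "ennreal (chi_square_density a s) * ennreal (chi_square_density b (w - s)) = 0" for s
    by (auto simp: chi_square_density_def)
  then have "(\<integral>\<^sup>+s. ennreal (chi_square_density a s) * ennreal (chi_square_density b (w - s)) \<partial>lborel) = 0"
    by (simp only: nn_integral_const) simp
  then show ?thesis using False by (simp add: chi_square_density_def)
next
  case True
  define K where "K = w powr ((a + b) / 2 - 1) * exp (- w / 2) / (2 powr ((a + b) / 2) * Gamma (a / 2) * Gamma (b / 2))"
  have G: "Gamma (a / 2) > 0" "Gamma (b / 2) > 0" "Gamma ((a + b) / 2) > 0"
    using assms by (auto intro!: Gamma_real_pos)
  have K: "K \<ge> 0" using G by (auto simp: K_def)
  have pt: "w * (chi_square_density a (w * t) * chi_square_density b (w - w * t))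
      = K * (indicator {0..1} t * (t powr (a / 2 - 1) * (1 - t) powr (b / 2 - 1)))" if "t \<noteq> 0" "t \<noteq> 1" for t
  proof (cases "0 < t \<and> t < 1")
    case False
    then show ?thesis using True that by (auto simp: chi_square_density_def indicator_def zero_less_mult_iff mult_le_cancel_left1)
  next
    case t: True
    have e: "exp (- (w * t) / 2) * exp (- (w - w * t) / 2) = exp (- w / 2)"
      by (simp add: exp_add[symmetric] field_simps)
    have w: "w * (w powr (a / 2 - 1) * w powr (b / 2 - 1)) = w powr ((a + b) / 2 - 1)"
    proof -
      have "w * (w powr (a / 2 - 1) * w powr (b / 2 - 1)) = w powr 1 * (w powr (a / 2 - 1) * w powr (b / 2 - 1))"
        using True by simp
      also have "\<dots> = w powr ((a + b) / 2 - 1)"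
        by (simp only: powr_add[symmetric]) (simp add: add_divide_distrib)
      finally show ?thesis .
    qed
    have "w - w * t = w * (1 - t)" by (simp add: algebra_simps)
    then have "w * (chi_square_density a (w * t) * chi_square_density b (w - w * t))
      = (w * (w powr (a / 2 - 1) * w powr (b / 2 - 1))) * (exp (- (w * t) / 2) * exp (- (w - w * t) / 2))
        * (t powr (a / 2 - 1) * (1 - t) powr (b / 2 - 1)) / ((2 powr (a / 2) * 2 powr (b / 2)) * Gamma (a / 2) * Gamma (b / 2))"
      using t True by (simp add: chi_square_density_def powr_mult mult_ac)
    also have "2 powr (a / 2) * 2 powr (b / 2) = (2::real) powr ((a + b) / 2)"
      by (simp add: powr_add[symmetric] add_divide_distrib)
    finally show ?thesis using t unfolding e w K_def by (simp add: field_simps)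
  qed
  have "((\<lambda>t. t powr (a / 2 - 1) * (1 - t) powr (b / 2 - 1)) has_integral Beta (a / 2) (b / 2)) {0..1}"
    using assms by (intro has_integral_Beta_real) auto
  from nn_integral_has_integral_lebesgue[OF _ this]
  have beta: "(\<integral>\<^sup>+t. ennreal (indicator {0..1} t * (t powr (a / 2 - 1) * (1 - t) powr (b / 2 - 1))) \<partial>lborel) = Beta (a / 2) (b / 2)"
    by simp
  have "(\<integral>\<^sup>+s. ennreal (chi_square_density a s) * ennreal (chi_square_density b (w - s)) \<partial>lborel)
      = ennreal w * (\<integral>\<^sup>+t. ennreal (chi_square_density a (w * t)) * ennreal (chi_square_density b (w - w * t)) \<partial>lborel)"
    using True by (subst nn_integral_real_affine[where c = w and t = 0]) auto
  also have "\<dots> = (\<integral>\<^sup>+t. ennreal w * (ennreal (chi_square_density a (w * t)) * ennreal (chi_square_density b (w - w * t))) \<partial>lborel)"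
    by (subst nn_integral_cmult) auto
  also have "\<dots> = (\<integral>\<^sup>+t. ennreal K * ennreal (indicator {0..1} t * (t powr (a / 2 - 1) * (1 - t) powr (b / 2 - 1))) \<partial>lborel)"
  proof (rule nn_integral_cong_AE)
    show "AE t in lborel. ennreal w * (ennreal (chi_square_density a (w * t)) * ennreal (chi_square_density b (w - w * t)))
        = ennreal K * ennreal (indicator {0..1} t * (t powr (a / 2 - 1) * (1 - t) powr (b / 2 - 1)))"
      using AE_lborel_singleton[of "0::real"] AE_lborel_singleton[of "1::real"]
      by eventually_elim
        (use True K assms pt in \<open>simp add: ennreal_mult'[symmetric] ennreal_mult''[symmetric] chi_square_density_nonneg\<close>)
  qed
  also have "\<dots> = ennreal K * ennreal (Beta (a / 2) (b / 2))"
    by (subst nn_integral_cmult) (auto simp: beta)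
  also have "\<dots> = chi_square_density (a + b) w"
    using True G K by (simp add: ennreal_mult'[symmetric] K_def Beta_def chi_square_density_def add_divide_distrib)
  finally show ?thesis .
qed

text \<open>Adding a coordinate convolves the density with that of one squared normal.
  \<open>h\<close> is kept general because the induction hypothesis is applied to \<open>h\<close>
  averaged over the new coordinate.\<close>

lemma nn_integral_sum_squares_std_normal:
  fixes h :: "real \<Rightarrow> ennreal"
  assumes "finite I" "I \<noteq> {}" and "h \<in> borel_measurable borel"
  shows "(\<integral>\<^sup>+x. h (\<Sum>i\<in>I. (x i)\<^sup>2) \<partial>PiM I (\<lambda>_. std_normal_distribution))
       = (\<integral>\<^sup>+s. chi_square_density (real (card I)) s * h s \<partial>lborel)"
  using assms
proof (induction I arbitrary: h rule: finite_ne_induct)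
  interpret N: prob_space std_normal_distribution by (rule prob_space_normal_density) simp
  interpret P: product_sigma_finite "\<lambda>_. std_normal_distribution" ..
  {
    case (singleton i)
    note [measurable] = singleton
    show ?case
      using nn_integral_std_normal_square[OF singleton] P.product_nn_integral_singleton[of "\<lambda>x. h (x\<^sup>2)" i]
      by simp
  next
    case (insert j I)
    note [measurable] = insert.prems
    let ?n = "real (card I)"
    have n: "?n > 0" using insert by (simp add: card_gt_0_iff)
    have "(\<integral>\<^sup>+x. h (\<Sum>i\<in>insert j I. (x i)\<^sup>2) \<partial>PiM (insert j I) (\<lambda>_. std_normal_distribution))
        = (\<integral>\<^sup>+x. (\<integral>\<^sup>+y. h (\<Sum>i\<in>insert j I. ((x(j := y)) i)\<^sup>2) \<partial>std_normal_distribution) \<partial>PiM I (\<lambda>_. std_normal_distribution))"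
      using insert by (intro P.product_nn_integral_insert) auto
    also have "\<dots> = (\<integral>\<^sup>+x. (\<integral>\<^sup>+y. h (y\<^sup>2 + (\<Sum>i\<in>I. (x i)\<^sup>2)) \<partial>std_normal_distribution) \<partial>PiM I (\<lambda>_. std_normal_distribution))"
    proof (intro nn_integral_cong arg_cong[where f = h])
      fix x :: "_ \<Rightarrow> real" and y
      have "(\<Sum>i\<in>I. ((x(j := y)) i)\<^sup>2) = (\<Sum>i\<in>I. (x i)\<^sup>2)" using insert by (intro sum.cong) auto
      then show "(\<Sum>i\<in>insert j I. ((x(j := y)) i)\<^sup>2) = y\<^sup>2 + (\<Sum>i\<in>I. (x i)\<^sup>2)" using insert by simp
    qed
    also have "\<dots> = (\<integral>\<^sup>+s. chi_square_density ?n s * (\<integral>\<^sup>+y. h (y\<^sup>2 + s) \<partial>std_normal_distribution) \<partial>lborel)"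
      by (rule insert.IH[of "\<lambda>s. \<integral>\<^sup>+y. h (y\<^sup>2 + s) \<partial>std_normal_distribution"]) measurable
    also have "\<dots> = (\<integral>\<^sup>+s. chi_square_density ?n s * (\<integral>\<^sup>+u. chi_square_density 1 u * h (u + s) \<partial>lborel) \<partial>lborel)"
      using nn_integral_std_normal_square[of "\<lambda>u. h (u + _)"] by simp
    also have "\<dots> = (\<integral>\<^sup>+s. chi_square_density ?n s * (\<integral>\<^sup>+w. chi_square_density 1 (w - s) * h w \<partial>lborel) \<partial>lborel)"
    proof -
      have "(\<integral>\<^sup>+u. chi_square_density 1 u * h (u + s) \<partial>lborel) = (\<integral>\<^sup>+w. chi_square_density 1 (w - s) * h w \<partial>lborel)" for s
        by (subst nn_integral_real_affine[where c = 1 and t = "-s"]) auto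
      then show ?thesis by simp
    qed
    also have "\<dots> = (\<integral>\<^sup>+s. \<integral>\<^sup>+w. chi_square_density ?n s * (chi_square_density 1 (w - s) * h w) \<partial>lborel \<partial>lborel)"
      by (intro nn_integral_cong nn_integral_cmult[symmetric]) auto
    also have "\<dots> = (\<integral>\<^sup>+w. \<integral>\<^sup>+s. chi_square_density ?n s * (chi_square_density 1 (w - s) * h w) \<partial>lborel \<partial>lborel)"
      by (intro lborel_pair.Fubini') measurable
    also have "\<dots> = (\<integral>\<^sup>+w. (\<integral>\<^sup>+s. ennreal (chi_square_density ?n s) * ennreal (chi_square_density 1 (w - s)) \<partial>lborel) * h w \<partial>lborel)"
      by (intro nn_integral_cong) (subst nn_integral_multc[symmetric], auto simp: mult.assoc)
    also have "\<dots> = (\<integral>\<^sup>+w. chi_square_density (real (card (insert j I))) w * h w \<partial>lborel)"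
      using n insert by (simp add: chi_square_density_convolution add.commute)
    finally show ?case .
  }
qed

text \<open>Given the value \<open>s\<close> of the denominator's sum of squares, the ratio is a
  normal variable divided by \<open>sqrt (s / q)\<close>, whose density at \<open>t\<close> is the
  second factor. Averaging over \<open>s\<close> is a Gamma integral.\<close>

lemma nn_integral_chi_square_normal_mixture:
  assumes q: "q > 0"
  shows "(\<integral>\<^sup>+s. ennreal (chi_square_density (real q) s) * ennreal (sqrt (s / q) * std_normal_density (sqrt (s / q) * t)) \<partial>lborel)
     = t_density q t"
proof -
  \<comment> \<open>\<open>b\<close> is the total coefficient of \<open>s\<close> in the negated
    exponent, \<open>a - 1\<close> is the total power of \<open>s\<close>, and \<open>K\<close>
    gathers the constants of both densities. Rescaling by \<open>b\<close> then produces
    \<open>Gamma a\<close>.\<close>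
  define b where "b = (1 + t\<^sup>2 / q) / 2"
  define a where "a = (real q + 1) / 2"
  define K where "K = 1 / (2 powr (q / 2) * Gamma (q / 2) * sqrt q * sqrt (2 * pi))"
  have b: "b > 0" using q by (simp add: b_def add_pos_nonneg)
  have G: "Gamma (real q / 2) > 0" using q by (intro Gamma_real_pos) auto
  have a: "a > 0" by (simp add: a_def)
  have K: "K \<ge> 0" using G by (simp add: K_def)
  have pt: "chi_square_density (real q) s * (sqrt (s / q) * std_normal_density (sqrt (s / q) * t))
      = K * b powr (1 - a) * (indicator {0..} (b * s) * (b * s) powr (a - 1) / exp (b * s))" for s
  proof (cases "s > 0")
    case False
    then show ?thesis using b by (auto simp: chi_square_density_def indicator_def zero_le_mult_iff)
  next
    case True
    have e: "exp (- s / 2) * exp (- (sqrt (s / q) * t)\<^sup>2 / 2) = 1 / exp (b * s)"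
      using True q by (simp add: exp_add[symmetric] b_def power_mult_distrib exp_minus[symmetric] field_simps)
    have p: "s powr (real q / 2 - 1) * sqrt s = s powr (a - 1)"
      using True by (simp add: powr_half_sqrt[symmetric] powr_add[symmetric] a_def field_simps)
    have bb: "b powr (1 - a) * b powr (a - 1) = 1" using b by (simp add: powr_add[symmetric])
    have "chi_square_density (real q) s * (sqrt (s / q) * std_normal_density (sqrt (s / q) * t))
      = (s powr (real q / 2 - 1) * sqrt s) * (exp (- s / 2) * exp (- (sqrt (s / q) * t)\<^sup>2 / 2)) * K"
      using True by (simp add: chi_square_density_def std_normal_density_def K_def real_sqrt_divide mult_ac)
    also have "\<dots> = s powr (a - 1) / exp (b * s) * K * (b powr (1 - a) * b powr (a - 1))"
      unfolding e p bb by simp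
    finally show ?thesis using True b by (simp add: powr_mult mult_ac)
  qed
  have "(\<integral>\<^sup>+s. ennreal (chi_square_density (real q) s) * ennreal (sqrt (s / q) * std_normal_density (sqrt (s / q) * t)) \<partial>lborel)
    = (\<integral>\<^sup>+s. ennreal (K * b powr (1 - a)) * ennreal (indicator {0..} (b * s) * (b * s) powr (a - 1) / exp (b * s)) \<partial>lborel)"
    using q K by (intro nn_integral_cong) (simp add: ennreal_mult'[symmetric] chi_square_density_nonneg pt[simplified])
  also have "\<dots> = ennreal (K * b powr (1 - a)) * (\<integral>\<^sup>+s. ennreal (indicator {0..} (b * s) * (b * s) powr (a - 1) / exp (b * s)) \<partial>lborel)"
    by (intro nn_integral_cmult) measurable
  also have "(\<integral>\<^sup>+s. ennreal (indicator {0..} (b * s) * (b * s) powr (a - 1) / exp (b * s)) \<partial>lborel) = ennreal (Gamma a / b)"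
  proof -
    have "ennreal (Gamma a) = ennreal b * (\<integral>\<^sup>+s. ennreal (indicator {0..} (b * s) * (b * s) powr (a - 1) / exp (b * s)) \<partial>lborel)"
      unfolding Gamma_conv_nn_integral_real[OF a]
      using b by (subst nn_integral_real_affine[where c = b and t = 0]) auto
    then have "ennreal (1 / b) * ennreal (Gamma a) = (ennreal (1 / b) * ennreal b) * (\<integral>\<^sup>+s. ennreal (indicator {0..} (b * s) * (b * s) powr (a - 1) / exp (b * s)) \<partial>lborel)"
      by (simp add: mult.assoc)
    also have "ennreal (1 / b) * ennreal b = 1" using b by (simp add: ennreal_mult[symmetric])
    finally show ?thesis using b by (simp add: ennreal_mult'[symmetric])
  qed
  also have "ennreal (K * b powr (1 - a)) * ennreal (Gamma a / b) = ennreal (K * b powr (1 - a) * (Gamma a / b))"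
    using K by (simp add: ennreal_mult'[symmetric])
  also have "K * b powr (1 - a) * (Gamma a / b) = t_density q t"
  proof -
    have "b powr (1 - a) / b = b powr (- a)" using b by (simp add: powr_diff powr_minus field_simps)
    also have "\<dots> = (1 + t\<^sup>2 / q) powr (- a) * 2 powr a"
      unfolding b_def by (simp add: powr_divide powr_minus field_simps)
    finally have 1: "b powr (1 - a) / b = (1 + t\<^sup>2 / q) powr (- a) * 2 powr a" .
    have "(2::real) powr a = 2 powr (q / 2) * sqrt 2"
      by (simp add: a_def powr_half_sqrt[symmetric] powr_add[symmetric] add_divide_distrib)
    then have 2: "2 powr a * K = 1 / (sqrt (q * pi) * Gamma (q / 2))"
      by (simp add: K_def real_sqrt_mult)
    have "K * b powr (1 - a) * (Gamma a / b) = K * Gamma a * (b powr (1 - a) / b)" by simp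
    also have "\<dots> = Gamma a * (2 powr a * K) * (1 + t\<^sup>2 / q) powr (- a)"
      unfolding 1 by simp
    also have "\<dots> = t_density q t"
      unfolding 2 by (simp add: t_density_def a_def minus_divide_left)
    finally show ?thesis .
  qed
  finally show ?thesis .
qed

lemma t_density_measurable [measurable]: "t_density q \<in> borel_measurable borel"
  unfolding t_density_def[abs_def] by measurable

text \<open>Coordinate \<open>j\<close> is integrated with the others fixed. Changing variables to
  the value \<open>t\<close> of the ratio and exchanging the integrals exposes the normal
  mixture.\<close>

lemma distr_normal_ratio_student_t:
  fixes j :: 'i
  assumes I: "finite I" "I \<noteq> {}" "j \<notin> I"
  shows "distr (PiM (insert j I) (\<lambda>_. std_normal_distribution)) borel
           (\<lambda>x. x j / sqrt ((1 / real (card I)) * (\<Sum>i\<in>I. (x i)\<^sup>2))) = student_t (card I)"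
proof -
  interpret N: prob_space std_normal_distribution by (rule prob_space_normal_density) simp
  interpret P: product_sigma_finite "\<lambda>_::'i. std_normal_distribution" ..
  define q where "q = card I"
  have q: "q > 0" using I by (simp add: q_def card_gt_0_iff)
  let ?g = "\<lambda>x::'i \<Rightarrow> real. x j / sqrt ((1 / real q) * (\<Sum>i\<in>I. (x i)\<^sup>2))"
  have [measurable]: "?g \<in> borel_measurable (PiM (insert j I) (\<lambda>_. std_normal_distribution))"
    by measurable
  have "distr (PiM (insert j I) (\<lambda>_. std_normal_distribution)) borel ?g = density lborel (t_density q)"
  proof (rule measure_eqI)
    fix B assume "B \<in> sets (distr (PiM (insert j I) (\<lambda>_. std_normal_distribution)) borel ?g)"
    then have [measurable]: "B \<in> sets borel" by simp
    let ?f = "indicator B :: real \<Rightarrow> ennreal"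
    have "emeasure (distr (PiM (insert j I) (\<lambda>_. std_normal_distribution)) borel ?g) B
       = (\<integral>\<^sup>+x. ?f (?g x) \<partial>PiM (insert j I) (\<lambda>_. std_normal_distribution))"
      by (subst nn_integral_indicator[symmetric]) (simp_all add: nn_integral_distr del: nn_integral_indicator)
    also have "\<dots> = (\<integral>\<^sup>+x. (\<integral>\<^sup>+y. ?f (?g (x(j := y))) \<partial>std_normal_distribution) \<partial>PiM I (\<lambda>_. std_normal_distribution))"
      using I by (intro P.product_nn_integral_insert) auto
    also have "\<dots> = (\<integral>\<^sup>+x. (\<integral>\<^sup>+y. ?f (y / sqrt ((1 / real q) * (\<Sum>i\<in>I. (x i)\<^sup>2))) \<partial>std_normal_distribution) \<partial>PiM I (\<lambda>_. std_normal_distribution))"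
    proof (intro nn_integral_cong arg_cong[where f = ?f])
      fix x :: "_ \<Rightarrow> real" and y
      have "(\<Sum>i\<in>I. ((x(j := y)) i)\<^sup>2) = (\<Sum>i\<in>I. (x i)\<^sup>2)" using I by (intro sum.cong) auto
      then show "?g (x(j := y)) = y / sqrt ((1 / real q) * (\<Sum>i\<in>I. (x i)\<^sup>2))" by simp
    qed
    also have "\<dots> = (\<integral>\<^sup>+s. chi_square_density q s * (\<integral>\<^sup>+y. ?f (y / sqrt ((1 / real q) * s)) \<partial>std_normal_distribution) \<partial>lborel)"
      unfolding q_def using I
      by (intro nn_integral_sum_squares_std_normal[where h = "\<lambda>s. \<integral>\<^sup>+y. ?f (y / sqrt ((1 / real (card I)) * s)) \<partial>std_normal_distribution"]) measurable
    also have "\<dots> = (\<integral>\<^sup>+s. \<integral>\<^sup>+t. chi_square_density q s * (ennreal (sqrt (s / q) * std_normal_density (sqrt (s / q) * t)) * ?f t) \<partial>lborel \<partial>lborel)"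
    proof (intro nn_integral_cong)
      fix s
      show "chi_square_density q s * (\<integral>\<^sup>+y. ?f (y / sqrt ((1 / real q) * s)) \<partial>std_normal_distribution)
        = (\<integral>\<^sup>+t. chi_square_density q s * (ennreal (sqrt (s / q) * std_normal_density (sqrt (s / q) * t)) * ?f t) \<partial>lborel)"
      proof (cases "s > 0")
        \<comment> \<open>The vanishing density hides the values of \<open>s\<close> at which the
          ratio would divide by zero or take the root of a negative number.\<close>
        case False
        then show ?thesis by (simp add: chi_square_density_def)
      next
        case True
        then have c: "sqrt (s / q) > 0" "s / q > 0" using q by simp_all
        have "(\<integral>\<^sup>+y. ?f (y / sqrt ((1 / real q) * s)) \<partial>std_normal_distribution)
          = (\<integral>\<^sup>+y. std_normal_density y * ?f (y / sqrt (s / q)) \<partial>lborel)"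
          by (subst nn_integral_density) auto
        also have "\<dots> = ennreal (sqrt (s / q)) * (\<integral>\<^sup>+t. std_normal_density (sqrt (s / q) * t) * ?f t \<partial>lborel)"
          using c True q by (subst nn_integral_real_affine[where c = "sqrt (s / q)" and t = 0]) auto
        also have "\<dots> = (\<integral>\<^sup>+t. ennreal (sqrt (s / q) * std_normal_density (sqrt (s / q) * t)) * ?f t \<partial>lborel)"
          using c by (subst nn_integral_cmult[symmetric]) (auto simp: ennreal_mult mult.assoc intro!: nn_integral_cong)
        finally show ?thesis by (simp add: nn_integral_cmult)
      qed
    qed
    also have "\<dots> = (\<integral>\<^sup>+t. \<integral>\<^sup>+s. chi_square_density q s * (ennreal (sqrt (s / q) * std_normal_density (sqrt (s / q) * t)) * ?f t) \<partial>lborel \<partial>lborel)"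
      by (intro lborel_pair.Fubini') measurable
    also have "\<dots> = (\<integral>\<^sup>+t. (\<integral>\<^sup>+s. ennreal (chi_square_density q s) * ennreal (sqrt (s / q) * std_normal_density (sqrt (s / q) * t)) \<partial>lborel) * ?f t \<partial>lborel)"
      by (intro nn_integral_cong) (subst nn_integral_multc[symmetric], auto simp: mult.assoc)
    also have "\<dots> = (\<integral>\<^sup>+t. t_density q t * ?f t \<partial>lborel)"
      unfolding nn_integral_chi_square_normal_mixture[OF q] ..
    also have "\<dots> = emeasure (density lborel (t_density q)) B"
      by (simp add: emeasure_density)
    finally show "emeasure (distr (PiM (insert j I) (\<lambda>_. std_normal_distribution)) borel ?g) B = emeasure (density lborel (t_density q)) B" .
  qed simp
  then show ?thesis unfolding student_t_def q_def .
qed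

section \<open>Convergence in distribution through an almost everywhere continuous map\<close>

text \<open>A Slutsky argument in which uniform continuity stands in for tightness: one
  \<open>d\<close> serves all points and all \<open>k\<close>, and off the event
  \<open>norm (Y k x - Z k x) < d\<close> the crude bound \<open>2 * B\<close> meets vanishing
  probability.\<close>

lemma (in prob_space) tendsto_integral_uniformly_continuous_op1:
  fixes Y Z :: "nat \<Rightarrow> 'a \<Rightarrow> 'b::{second_countable_topology, real_normed_vector}" and F :: "'b \<Rightarrow> real"
  assumes [measurable]: "\<And>k. Y k \<in> borel_measurable M" "\<And>k. Z k \<in> borel_measurable M"
    and op: "op1 M (\<lambda>k x. Y k x - Z k x)"
    and F: "uniformly_continuous_on UNIV F" and F_le: "\<And>y. \<bar>F y\<bar> \<le> B"
    and lim: "(\<lambda>k. \<integral>x. F (Z k x) \<partial>M) \<longlonglongrightarrow> l"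
  shows "(\<lambda>k. \<integral>x. F (Y k x) \<partial>M) \<longlonglongrightarrow> l"
proof -
  have [measurable]: "F \<in> borel_measurable borel"
    using F by (intro borel_measurable_continuous_onI uniformly_continuous_imp_continuous)
  have intF: "integrable M (\<lambda>x. F (V x))" if [measurable]: "V \<in> borel_measurable M" for V
    using F_le by (intro integrable_const_bound[where B = B]) auto
  have "(\<lambda>k. (\<integral>x. F (Y k x) \<partial>M) - (\<integral>x. F (Z k x) \<partial>M)) \<longlonglongrightarrow> 0"
  proof (rule LIMSEQ_I)
    fix e :: real assume "0 < e"
    then obtain d where d: "d > 0" "\<And>y z. dist y z < d \<Longrightarrow> dist (F y) (F z) < e / 2"
      using F unfolding uniformly_continuous_on_def by (metis half_gt_zero UNIV_I)
    define E where "E k = {x \<in> space M. d \<le> norm (Y k x - Z k x)}" for k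
    have [measurable]: "E k \<in> sets M" for k unfolding E_def by measurable
    have "(\<lambda>k. 2 * B * prob (E k)) \<longlonglongrightarrow> 2 * B * 0"
      using op d(1) unfolding op1_def E_def by (intro tendsto_intros) auto
    then have "eventually (\<lambda>k. 2 * B * prob (E k) < e / 2) sequentially"
      using \<open>0 < e\<close> by (intro order_tendstoD) auto
    then have "eventually (\<lambda>k. norm ((\<integral>x. F (Y k x) \<partial>M) - (\<integral>x. F (Z k x) \<partial>M) - 0) < e) sequentially"
    proof eventually_elim
      case (elim k)
      have "norm ((\<integral>x. F (Y k x) \<partial>M) - (\<integral>x. F (Z k x) \<partial>M)) = norm (\<integral>x. F (Y k x) - F (Z k x) \<partial>M)"
        by (simp add: intF)
      also have "\<dots> \<le> (\<integral>x. norm (F (Y k x) - F (Z k x)) \<partial>M)"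
        by (rule integral_norm_bound)
      also have "\<dots> \<le> (\<integral>x. e / 2 + 2 * B * indicator (E k) x \<partial>M)"
      proof (rule integral_mono)
        fix x assume x: "x \<in> space M"
        show "norm (F (Y k x) - F (Z k x)) \<le> e / 2 + 2 * B * indicator (E k) x"
        proof (cases "x \<in> E k")
          case True
          then show ?thesis using F_le[of "Y k x"] F_le[of "Z k x"] \<open>0 < e\<close> by auto
        next
          case False
          then show ?thesis using d(2)[of "Y k x" "Z k x"] x by (auto simp: E_def dist_norm)
        qed
      qed (auto intro!: intF Bochner_Integration.integrable_diff integrable_norm simp: less_top[symmetric])
      also have "\<dots> = e / 2 + 2 * B * prob (E k)"
        by (simp add: prob_space less_top[symmetric])
      finally show ?case using elim by simp
    qed
    then show "\<exists>no. \<forall>n\<ge>no. norm ((\<integral>x. F (Y n x) \<partial>M) - (\<integral>x. F (Z n x) \<partial>M) - 0) < e"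
      by (simp add: eventually_sequentially)
  qed
  from tendsto_add[OF this lim] show ?thesis by simp
qed

text \<open>Inserting \<open>\<psi> n\<close> costs at most \<open>B\<close> times the mean of
  \<open>1 - \<psi> n\<close>. By \<open>lim1\<close> this cost under \<open>M\<close> approaches
  the cost under \<open>L\<close>, which dominated convergence makes small, so no separate tightness
  bound is required.\<close>

lemma (in prob_space) tendsto_integral_of_cutoff:
  fixes Y :: "nat \<Rightarrow> 'a \<Rightarrow> 'b" and h :: "'b \<Rightarrow> real" and \<psi> :: "nat \<Rightarrow> 'b \<Rightarrow> real"
  assumes L: "prob_space L"
    and [measurable]: "\<And>k. Y k \<in> measurable M L" "h \<in> borel_measurable L" "\<And>n. \<psi> n \<in> borel_measurable L"
    and h_le: "\<And>y. \<bar>h y\<bar> \<le> B"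
    and \<psi>: "\<And>n y. 0 \<le> \<psi> n y" "\<And>n y. \<psi> n y \<le> 1" and \<psi>_lim: "AE y in L. (\<lambda>n. \<psi> n y) \<longlonglongrightarrow> 1"
    and lim: "\<And>n. (\<lambda>k. \<integral>x. h (Y k x) * \<psi> n (Y k x) \<partial>M) \<longlonglongrightarrow> (\<integral>y. h y * \<psi> n y \<partial>L)"
    and lim1: "\<And>n. (\<lambda>k. \<integral>x. \<psi> n (Y k x) \<partial>M) \<longlonglongrightarrow> (\<integral>y. \<psi> n y \<partial>L)"
  shows "(\<lambda>k. \<integral>x. h (Y k x) \<partial>M) \<longlonglongrightarrow> (\<integral>y. h y \<partial>L)"
proof (rule LIMSEQ_I)
  fix e :: real assume e: "0 < e"
  interpret L: prob_space L by fact
  have B: "B \<ge> 0" using h_le[of undefined] by linarith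
  \<comment> \<open>Stated for a general measure and map because it is used for \<open>Y k\<close>
    under \<open>M\<close> and for the identity under \<open>L\<close>.\<close>
  have tail: "\<bar>(\<integral>x. h (V x) \<partial>N) - (\<integral>x. h (V x) * \<psi> n (V x) \<partial>N)\<bar> \<le> B * (1 - (\<integral>x. \<psi> n (V x) \<partial>N))"
    if N: "prob_space N" and [measurable]: "V \<in> measurable N L" for V :: "'c \<Rightarrow> 'b" and N n
  proof -
    interpret N: prob_space N by fact
    have i1: "integrable N (\<lambda>x. h (V x))"
      using h_le by (intro N.integrable_const_bound[where B = B]) auto
    have i2: "integrable N (\<lambda>x. \<psi> n (V x))"
      using \<psi> by (intro N.integrable_const_bound[where B = 1]) auto
    have i3: "integrable N (\<lambda>x. h (V x) * \<psi> n (V x))"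
      using h_le \<psi> B
      by (intro N.integrable_const_bound[where B = "B * 1"]) (auto simp: abs_mult intro!: AE_I2 mult_mono simp del: mult_1_right)
    have "\<bar>(\<integral>x. h (V x) \<partial>N) - (\<integral>x. h (V x) * \<psi> n (V x) \<partial>N)\<bar> = norm (\<integral>x. h (V x) - h (V x) * \<psi> n (V x) \<partial>N)"
      using i1 i3 by simp
    also have "\<dots> \<le> (\<integral>x. norm (h (V x) - h (V x) * \<psi> n (V x)) \<partial>N)"
      by (rule integral_norm_bound)
    also have "\<dots> \<le> (\<integral>x. B * (1 - \<psi> n (V x)) \<partial>N)"
    proof (rule integral_mono)
      fix x
      have "h (V x) - h (V x) * \<psi> n (V x) = h (V x) * (1 - \<psi> n (V x))" by (simp add: algebra_simps)
      then show "norm (h (V x) - h (V x) * \<psi> n (V x)) \<le> B * (1 - \<psi> n (V x))"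
        using h_le[of "V x"] \<psi>(2)[of n "V x"] by (simp add: abs_mult mult_right_mono)
    qed (use i1 i2 i3 in auto)
    also have "\<dots> = B * (1 - (\<integral>x. \<psi> n (V x) \<partial>N))"
      using i2 by (simp add: N.prob_space)
    finally show ?thesis .
  qed
  have "(\<lambda>n. \<integral>y. \<psi> n y \<partial>L) \<longlonglongrightarrow> (\<integral>y. 1 \<partial>L)"
    using \<psi> \<psi>_lim by (intro integral_dominated_convergence[where w = "\<lambda>_. 1"]) auto
  \<comment> \<open>The factor 2 pays for the tail under \<open>L\<close> and for the limit of the
    tails under \<open>M\<close>.\<close>
  then have "(\<lambda>n. 2 * B * (1 - (\<integral>y. \<psi> n y \<partial>L))) \<longlonglongrightarrow> 2 * B * (1 - 1)"
    by (intro tendsto_intros) (simp add: L.prob_space)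
  then have "eventually (\<lambda>n. 2 * B * (1 - (\<integral>y. \<psi> n y \<partial>L)) < e) sequentially"
    using e by (intro order_tendstoD) auto
  then obtain n where n: "2 * B * (1 - (\<integral>y. \<psi> n y \<partial>L)) < e"
    by (auto simp: eventually_sequentially)
  let ?a = "\<lambda>k. \<bar>(\<integral>x. h (Y k x) * \<psi> n (Y k x) \<partial>M) - (\<integral>y. h y * \<psi> n y \<partial>L)\<bar>
     + B * (1 - (\<integral>x. \<psi> n (Y k x) \<partial>M)) + B * (1 - (\<integral>y. \<psi> n y \<partial>L))"
  have "?a \<longlonglongrightarrow> \<bar>(\<integral>y. h y * \<psi> n y \<partial>L) - (\<integral>y. h y * \<psi> n y \<partial>L)\<bar>
     + B * (1 - (\<integral>y. \<psi> n y \<partial>L)) + B * (1 - (\<integral>y. \<psi> n y \<partial>L))"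
    by (intro tendsto_intros lim lim1)
  then have "eventually (\<lambda>k. ?a k < e) sequentially"
    using n by (intro order_tendstoD) (auto simp: algebra_simps)
  then have "eventually (\<lambda>k. norm ((\<integral>x. h (Y k x) \<partial>M) - (\<integral>y. h y \<partial>L)) < e) sequentially"
  proof eventually_elim
    case (elim k)
    then show ?case using tail[of M "Y k" n] tail[of L "\<lambda>y. y" n] prob_space_axioms L by simp
  qed
  then show "\<exists>no. \<forall>k\<ge>no. norm ((\<integral>x. h (Y k x) \<partial>M) - (\<integral>y. h y \<partial>L)) < e"
    by (simp add: eventually_sequentially)
qed

lemma uniformly_continuous_on_UNIV_compact_support:
  fixes F :: "'b::euclidean_space \<Rightarrow> real"
  assumes cont: "continuous_on UNIV F" and supp: "\<And>y. R \<le> norm y \<Longrightarrow> F y = 0"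
  shows "uniformly_continuous_on UNIV F"
  unfolding uniformly_continuous_on_def
proof (intro allI impI)
  fix e :: real assume e: "0 < e"
  have "uniformly_continuous_on (cball 0 (R + 1)) F"
    using cont by (intro compact_uniformly_continuous compact_cball) (auto intro: continuous_on_subset)
  then obtain d where d: "d > 0" "\<And>x y. x \<in> cball 0 (R + 1) \<Longrightarrow> y \<in> cball 0 (R + 1) \<Longrightarrow> dist y x < d \<Longrightarrow> dist (F y) (F x) < e"
    using e unfolding uniformly_continuous_on_def by metis
  \<comment> \<open>The margin 1 puts two such points either both in the enlarged ball, or both
    where \<open>F\<close> vanishes.\<close>
  have "dist (F y) (F x) < e" if xy: "dist y x < min d 1" for x y
  proof (cases "x \<in> cball 0 (R + 1) \<and> y \<in> cball 0 (R + 1)")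
    case True
    then show ?thesis using d xy by auto
  next
    case False
    then have "R \<le> norm x" "R \<le> norm y"
      using xy norm_triangle_ineq2[of x y] norm_triangle_ineq2[of y x] by (auto simp: dist_norm norm_minus_commute)
    then show ?thesis using supp e by simp
  qed
  then show "\<exists>d>0. \<forall>x\<in>UNIV. \<forall>y\<in>UNIV. dist y x < d \<longrightarrow> dist (F y) (F x) < e"
    using d(1) by (intro exI[of _ "min d 1"]) auto
qed

text \<open>\<open>G\<close> witnesses that the discontinuities of \<open>h\<close> are negligible:
  being continuous, it yields a continuous cutoff that vanishes on all of them, while its zero set
  is null under the limit law.\<close>

lemma (in prob_space) conv_distr_integral_mapping:
  fixes Y Z :: "nat \<Rightarrow> 'a \<Rightarrow> 'b::euclidean_space" and h G :: "'b \<Rightarrow> real"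
  assumes L: "prob_space L" "sets L = sets borel" and Z: "conv_distr M Z L"
    and [measurable]: "\<And>k. Y k \<in> borel_measurable M" "\<And>k. Z k \<in> borel_measurable M" "h \<in> borel_measurable borel"
    and op: "op1 M (\<lambda>k x. Y k x - Z k x)"
    and h_le: "\<And>y. \<bar>h y\<bar> \<le> B"
    and G: "continuous_on UNIV G" "AE y in L. G y \<noteq> 0" and h_cont: "\<And>y. G y \<noteq> 0 \<Longrightarrow> isCont h y"
  shows "(\<lambda>k. \<integral>x. h (Y k x) \<partial>M) \<longlonglongrightarrow> (\<integral>y. h y \<partial>L)"
proof -
  \<comment> \<open>The first factor of the cutoff removes the discontinuities of \<open>h\<close>; the second gives compact
    support, hence the uniform continuity needed to absorb the \<open>op1\<close> error.\<close>
  define \<psi> where "\<psi> n y = min 1 (real n * \<bar>G y\<bar>) * max 0 (min 1 (real n + 1 - norm y))" for n y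
  have \<psi>_cont: "continuous_on UNIV (\<psi> n)" for n
    unfolding \<psi>_def by (intro continuous_intros G)
  have \<psi>_bd: "0 \<le> \<psi> n y" "\<psi> n y \<le> 1" for n y
    by (auto simp: \<psi>_def intro!: mult_le_one)
  have B: "B \<ge> 0" using h_le[of undefined] by linarith
  have supp: "\<psi> n y = 0" if "real n + 1 \<le> norm y" for n y
    using that by (simp add: \<psi>_def)
  have conv: "(\<lambda>k. \<integral>x. F (Y k x) \<partial>M) \<longlonglongrightarrow> (\<integral>y. F y \<partial>L)"
    if "continuous_on UNIV F" "\<And>y. \<bar>F y\<bar> \<le> c" "\<And>y. R \<le> norm y \<Longrightarrow> F y = 0" for F :: "'b \<Rightarrow> real" and c R
  proof (rule tendsto_integral_uniformly_continuous_op1[where Y = Y and Z = Z and F = F])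
    show "uniformly_continuous_on UNIV F"
      using that by (intro uniformly_continuous_on_UNIV_compact_support)
    have "bounded (range F)" using that(2) by (auto simp: bounded_iff)
    then show "(\<lambda>k. \<integral>x. F (Z k x) \<partial>M) \<longlonglongrightarrow> (\<integral>y. F y \<partial>L)"
      using Z that(1) unfolding conv_distr_def by blast
  qed (use that op in auto)
  have h\<psi>_cont: "continuous_on UNIV (\<lambda>y. h y * \<psi> n y)" for n
  proof -
    have "isCont (\<lambda>y. h y * \<psi> n y) y" for y
    proof (cases "G y = 0")
      case False
      then show ?thesis
        using h_cont \<psi>_cont[of n] by (intro isCont_mult) (auto simp: continuous_on_eq_continuous_at)
    next
      case True
      \<comment> \<open>At a zero of \<open>G\<close> the function \<open>h\<close> may jump, but it
        is bounded and \<open>\<psi> n\<close> tends to 0 there.\<close>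
      have "((\<lambda>z. h z * \<psi> n z) \<longlongrightarrow> 0) (at y)"
      proof (rule Lim_null_comparison)
        show "eventually (\<lambda>z. norm (h z * \<psi> n z) \<le> B * \<psi> n z) (at y)"
          using h_le \<psi>_bd by (auto simp: abs_mult intro!: always_eventually mult_right_mono)
        have "isCont (\<psi> n) y" using \<psi>_cont[of n] by (simp add: continuous_on_eq_continuous_at)
        then have "(\<psi> n \<longlongrightarrow> \<psi> n y) (at y)" by (simp add: isCont_def)
        then have "((\<lambda>z. B * \<psi> n z) \<longlongrightarrow> B * \<psi> n y) (at y)" by (intro tendsto_intros)
        then show "((\<lambda>z. B * \<psi> n z) \<longlongrightarrow> 0) (at y)" using True by (simp add: \<psi>_def)
      qed
      then show ?thesis using True by (simp add: isCont_def \<psi>_def)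
    qed
    then show ?thesis by (simp add: continuous_on_eq_continuous_at)
  qed
  show ?thesis
  proof (rule tendsto_integral_of_cutoff[where \<psi> = \<psi>, OF L(1) _ _ _ h_le \<psi>_bd])
    note L(2)[measurable_cong] borel_measurable_continuous_onI[OF \<psi>_cont, measurable]
    show "Y k \<in> measurable M L" for k by measurable
    show "h \<in> borel_measurable L" by measurable
    show "\<psi> n \<in> borel_measurable L" for n by measurable
    show "AE y in L. (\<lambda>n. \<psi> n y) \<longlonglongrightarrow> 1"
      using G(2)
    proof eventually_elim
      case (elim y)
      \<comment> \<open>The two summands saturate the two factors of the cutoff:
        \<open>1 / \<bar>G y\<bar>\<close> the first, \<open>norm y\<close> the second.\<close>
      obtain N where N: "1 / \<bar>G y\<bar> + norm y \<le> real N" using real_arch_simple by blast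
      have "\<psi> n y = 1" if "n \<ge> N" for n
      proof -
        have le: "1 / \<bar>G y\<bar> + norm y \<le> real n" using N that by linarith
        moreover have "0 < 1 / \<bar>G y\<bar>" using elim by simp
        ultimately have "norm y \<le> real n" "1 / \<bar>G y\<bar> \<le> real n" using norm_ge_zero[of y] by linarith+
        then show ?thesis using elim by (simp add: \<psi>_def field_simps)
      qed
      then show ?case by (intro tendsto_eventually) (auto simp: eventually_sequentially)
    qed
    show "(\<lambda>k. \<integral>x. h (Y k x) * \<psi> n (Y k x) \<partial>M) \<longlonglongrightarrow> (\<integral>y. h y * \<psi> n y \<partial>L)" for n
    proof (rule conv[of "\<lambda>y. h y * \<psi> n y" "B * 1" "real n + 1"])
      show "\<bar>h y * \<psi> n y\<bar> \<le> B * 1" for y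
        unfolding abs_mult using h_le \<psi>_bd B by (intro mult_mono) auto
    qed (use h\<psi>_cont supp in auto)
    show "(\<lambda>k. \<integral>x. \<psi> n (Y k x) \<partial>M) \<longlonglongrightarrow> (\<integral>y. \<psi> n y \<partial>L)" for n
      using \<psi>_cont supp \<psi>_bd by (intro conv[of "\<psi> n" 1 "real n + 1"]) auto
  qed
qed

section \<open>The limit law of the statistic\<close>

lemma quadratic_nonneg_imp_linear_coeff_zero:
  fixes a b :: real
  assumes "\<And>t. 0 \<le> 2 * t * a + t\<^sup>2 * b" and "0 \<le> b"
  shows "a = 0"
proof (rule ccontr)
  assume "a \<noteq> 0"
  \<comment> \<open>The minimiser would be \<open>- a / b\<close>; using \<open>b + 1\<close> covers
    \<open>b = 0\<close> and still gives a negative value.\<close>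
  have "2 * (- a / (b + 1)) * a + (- a / (b + 1))\<^sup>2 * b = - (a\<^sup>2 * (b + 2) / (b + 1)\<^sup>2)"
    using assms(2) by (simp add: divide_simps power2_eq_square) (simp add: algebra_simps)
  moreover have "a\<^sup>2 * (b + 2) / (b + 1)\<^sup>2 > 0"
    using \<open>a \<noteq> 0\<close> assms(2) by (intro divide_pos_pos mult_pos_pos) auto
  ultimately show False using assms(1)[of "- a / (b + 1)"] by linarith
qed

lemma symmetric_matrix_inner_commute:
  fixes C :: "real^'m^'m"
  assumes "transpose C = C"
  shows "x \<bullet> (C *v y) = y \<bullet> (C *v x)"
  by (metis assms dot_lmul_matrix inner_commute matrix_vector_mul_assoc transpose_matrix_vector)

lemma symmetric_quadratic_form_add_scaleR:
  fixes C :: "real^'m^'m"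
  assumes "transpose C = C"
  shows "(x + t *\<^sub>R y) \<bullet> (C *v (x + t *\<^sub>R y)) = x \<bullet> (C *v x) + (2 * t * (y \<bullet> (C *v x)) + t\<^sup>2 * (y \<bullet> (C *v y)))"
  using symmetric_matrix_inner_commute[OF assms, of x y]
  by (simp add: matrix_vector_right_distrib scaleR_matrix_vector_assoc[symmetric] matrix_vector_mult_scaleR inner_add_left inner_add_right power2_eq_square algebra_simps)

text \<open>A zero of a nonnegative form is a minimum, so every directional derivative vanishes
  there; the direction \<open>C *v x\<close> finishes.\<close>

lemma psd_quadratic_form_zero_imp_null:
  fixes C :: "real^'m^'m"
  assumes "transpose C = C" "\<And>x. 0 \<le> x \<bullet> (C *v x)" "x \<bullet> (C *v x) = 0"
  shows "C *v x = 0"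
proof -
  have "y \<bullet> (C *v x) = 0" for y
  proof (rule quadratic_nonneg_imp_linear_coeff_zero)
    fix t
    show "0 \<le> 2 * t * (y \<bullet> (C *v x)) + t\<^sup>2 * (y \<bullet> (C *v y))"
      using assms(2)[of "x + t *\<^sub>R y"] assms(3) unfolding symmetric_quadratic_form_add_scaleR[OF assms(1)] by simp
  qed (rule assms(2))
  from this[of "C *v x"] show ?thesis by simp
qed

section \<open>Linear images of the multivariate normal law\<close>

lemma mvn_law_distr_inner:
  fixes w :: "real^'m"
  assumes L: "mvn_law S L" and w: "w \<bullet> (S *v w) = 1"
  shows "distr L borel (\<lambda>x. w \<bullet> x) = std_normal_distribution"
proof -
  interpret L: prob_space L using L by (simp add: mvn_law_def)
  have sets_L [measurable_cong]: "sets L = sets borel" using L by (simp add: mvn_law_def)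
  have cf: "(CLINT x|L. iexp (t \<bullet> x)) = complex_of_real (exp (- (t \<bullet> (S *v t)) / 2))" for t
    using L by (simp add: mvn_law_def)
  have "char (distr L borel (\<lambda>x. w \<bullet> x)) = char std_normal_distribution"
  proof
    fix s
    have "char (distr L borel (\<lambda>x. w \<bullet> x)) s = (CLINT x|L. iexp ((s *\<^sub>R w) \<bullet> x))"
      by (simp add: char_def integral_distr)
    also have "\<dots> = char std_normal_distribution s"
      unfolding cf char_std_normal_distribution using w
      by (simp add: matrix_vector_mult_scaleR power2_eq_square)
    finally show "char (distr L borel (\<lambda>x. w \<bullet> x)) s = char std_normal_distribution s" .
  qed
  then show ?thesis
    by (intro Levy_uniqueness L.real_distribution_distr real_dist_normal_dist) auto
qed

text \<open>Evaluated at a combination of the \<open>w i\<close>, the quadratic form in the exponent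
  becomes a sum of squares of the coefficients, so the joint characteristic function is a product
  and Kac's theorem applies.\<close>

lemma mvn_law_distr_orthonormal:
  fixes w :: "'i::finite \<Rightarrow> real^'m"
  assumes L: "mvn_law S L" and w: "\<And>i j. w i \<bullet> (S *v w j) = (if i = j then 1 else 0)"
  shows "distr L (PiM UNIV (\<lambda>_. borel)) (\<lambda>x i. w i \<bullet> x) = PiM UNIV (\<lambda>_. std_normal_distribution)"
proof -
  interpret L: prob_space L using L by (simp add: mvn_law_def)
  have sets_L [measurable_cong]: "sets L = sets borel" using L by (simp add: mvn_law_def)
  have marg: "distr L borel (\<lambda>x. w i \<bullet> x) = std_normal_distribution" for i
    using mvn_law_distr_inner[OF L] w by simp
  have "distr L (PiM UNIV (\<lambda>_. borel)) (\<lambda>x. \<lambda>i\<in>UNIV. w i \<bullet> x) = PiM UNIV (\<lambda>i. distr L borel (\<lambda>x. w i \<bullet> x))"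
  proof (rule L.distr_PiM_eq_of_char_prod)
    fix t :: "'i \<Rightarrow> real"
    let ?t = "\<Sum>i\<in>UNIV. t i *\<^sub>R w i"
    have "?t \<bullet> (S *v ?t) = (\<Sum>i\<in>UNIV. \<Sum>j\<in>UNIV. t i * (t j * (w j \<bullet> (S *v w i))))"
      by (simp add: linear_sum[OF matrix_vector_mul_linear] matrix_vector_mult_scaleR inner_sum_left inner_sum_right sum_distrib_left)
    also have "\<dots> = (\<Sum>i\<in>UNIV. (t i)\<^sup>2)"
      by (simp add: w power2_eq_square if_distrib sum.delta cong: if_cong)
    finally have q: "?t \<bullet> (S *v ?t) = (\<Sum>i\<in>UNIV. (t i)\<^sup>2)" .
    have "(CLINT x|L. iexp (\<Sum>i\<in>UNIV. t i * (w i \<bullet> x))) = (CLINT x|L. iexp (?t \<bullet> x))"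
      by (simp add: inner_sum_left)
    also have "\<dots> = complex_of_real (exp (- (\<Sum>i\<in>UNIV. (t i)\<^sup>2) / 2))"
      using L unfolding mvn_law_def q[symmetric] by blast
    also have "\<dots> = (\<Prod>i\<in>UNIV. char std_normal_distribution (t i))"
      by (simp add: char_std_normal_distribution exp_sum[symmetric] sum_negf sum_divide_distrib flip: of_real_prod)
    finally show "(CLINT x|L. iexp (\<Sum>i\<in>UNIV. t i * (w i \<bullet> x))) = (\<Prod>i\<in>UNIV. char (distr L borel (\<lambda>x. w i \<bullet> x)) (t i))"
      by (simp only: marg)
  qed auto
  then show ?thesis by (simp add: marg restrict_UNIV)
qed

lemma mvn_law_ratio_student_t:
  fixes v :: "real^'m" and u :: "'q::finite \<Rightarrow> real^'m"
  assumes L: "mvn_law S L" and c: "c > 0" and v: "v \<bullet> (S *v v) = c"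
    and u: "\<And>k l. u k \<bullet> (S *v u l) = (if k = l then c else 0)"
    and vu: "\<And>l. v \<bullet> (S *v u l) = 0" "\<And>l. u l \<bullet> (S *v v) = 0"
  shows "distr L borel (\<lambda>y. (v \<bullet> y) / sqrt ((1 / real CARD('q)) * (\<Sum>l\<in>UNIV. (u l \<bullet> y)\<^sup>2))) = student_t CARD('q)"
    and "AE y in L. (\<Sum>l\<in>UNIV. (u l \<bullet> y)\<^sup>2) \<noteq> 0"
proof -
  have sets_L [measurable_cong]: "sets L = sets borel" using L by (simp add: mvn_law_def)
  \<comment> \<open>The option type indexes numerator and denominator together: \<open>None\<close>
    is the extra index outside \<open>range Some\<close>.\<close>
  define w where "w i = (1 / sqrt c) *\<^sub>R (case i of None \<Rightarrow> v | Some l \<Rightarrow> u l)" for i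
  have w: "w i \<bullet> (S *v w j) = (if i = j then 1 else 0)" for i j
    using c v u vu by (cases i; cases j) (simp_all add: w_def matrix_vector_mult_scaleR)
  have w_meas: "(\<lambda>y i. w i \<bullet> y) \<in> measurable L (PiM UNIV (\<lambda>_. borel))"
    by (rule measurable_PiM_single') (auto simp: space_PiM)
  let ?R = "range Some :: 'q option set"
  have R: "insert None ?R = UNIV" "card ?R = CARD('q)"
    by (auto simp: card_image UNIV_option_conv)
  have sumR: "(\<Sum>i\<in>?R. f i) = (\<Sum>l\<in>UNIV. f (Some l))" for f :: "'q option \<Rightarrow> real"
    by (subst sum.reindex) auto
  let ?N = "PiM (UNIV :: 'q option set) (\<lambda>_. std_normal_distribution)"
  let ?g = "\<lambda>x :: 'q option \<Rightarrow> real. x None / sqrt ((1 / real CARD('q)) * (\<Sum>i\<in>?R. (x i)\<^sup>2))"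
  have "student_t CARD('q) = distr ?N borel ?g"
    using distr_normal_ratio_student_t[of ?R None] unfolding R by auto
  also have "\<dots> = distr (distr L (PiM UNIV (\<lambda>_. borel)) (\<lambda>x i. w i \<bullet> x)) borel ?g"
    by (simp only: mvn_law_distr_orthonormal[OF L w])
  also have "\<dots> = distr L borel (\<lambda>y. ?g (\<lambda>i. w i \<bullet> y))"
    using w_meas by (subst distr_distr) (auto simp: comp_def)
  also have "(\<lambda>y. ?g (\<lambda>i. w i \<bullet> y)) = (\<lambda>y. (v \<bullet> y) / sqrt ((1 / real CARD('q)) * (\<Sum>l\<in>UNIV. (u l \<bullet> y)\<^sup>2)))"
  proof
    fix y
    have "(\<Sum>i\<in>?R. (w i \<bullet> y)\<^sup>2) = (\<Sum>l\<in>UNIV. (u l \<bullet> y)\<^sup>2) / c"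
      unfolding sumR using c by (simp add: w_def power_divide sum_divide_distrib)
    then show "?g (\<lambda>i. w i \<bullet> y) = (v \<bullet> y) / sqrt ((1 / real CARD('q)) * (\<Sum>l\<in>UNIV. (u l \<bullet> y)\<^sup>2))"
      using c by (simp add: w_def real_sqrt_divide real_sqrt_mult)
  qed
  finally show "distr L borel (\<lambda>y. (v \<bullet> y) / sqrt ((1 / real CARD('q)) * (\<Sum>l\<in>UNIV. (u l \<bullet> y)\<^sup>2))) = student_t CARD('q)" ..
  \<comment> \<open>One nonzero summand suffices. An index exists because types are nonempty, which
    encodes q >= 1.\<close>
  obtain l :: 'q where True by simp
  have "AE s in std_normal_distribution. s \<noteq> 0"
    using AE_lborel_singleton[of "0::real"] by (subst AE_density) auto
  moreover have "distr L borel (\<lambda>y. w (Some l) \<bullet> y) = std_normal_distribution"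
    using w by (intro mvn_law_distr_inner[OF L]) simp
  ultimately have "AE s in distr L borel (\<lambda>y. w (Some l) \<bullet> y). s \<noteq> 0"
    by (simp only:)
  then have "AE y in L. w (Some l) \<bullet> y \<noteq> 0"
    by (subst (asm) AE_distr_iff) auto
  then show "AE y in L. (\<Sum>l\<in>UNIV. (u l \<bullet> y)\<^sup>2) \<noteq> 0"
  proof eventually_elim
    case (elim y)
    then have "u l \<bullet> y \<noteq> 0" by (auto simp: w_def)
    then show ?case by (auto simp: sum_nonneg_eq_0_iff)
  qed
qed

section \<open>Application to the jackknife statistic\<close>

theorem theorem4:
  fixes M :: "'a measure"
    and NN TT :: "nat \<Rightarrow> nat" and \<gamma> :: real
    and r :: "nat \<Rightarrow> nat \<Rightarrow> real"
    and \<phi> :: real and \<sigma>2 :: real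
    and phihat :: "nat \<Rightarrow> nat \<Rightarrow> 'a \<Rightarrow> real^'m"
    and i0 :: 'm
    and \<mu> :: "nat \<Rightarrow> nat \<Rightarrow> real^'r"
    and zAD :: "nat \<Rightarrow> nat \<Rightarrow> 'a \<Rightarrow> real"
    and zJK :: "nat \<Rightarrow> nat \<Rightarrow> 'a \<Rightarrow> real^'m"
    and A :: "real^'r^'m" and C :: "real^'m^'m"
    and L :: "(real^'m) measure"
    and vs :: "real^'m" and U :: "real^'q^'m"
  assumes M: "prob_space M"
    (* the joint limit N,T \<rightarrow> \<infinity>, N/T \<rightarrow> \<gamma>\<^sup>2 \<in> (0,\<infinity>), along an arbitrary path *)
    and path: "filterlim NN at_top sequentially" "filterlim TT at_top sequentially"
      "\<gamma> > 0" "(\<lambda>k. real (NN k) / real (TT k)) \<longlonglongrightarrow> \<gamma>\<^sup>2"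
    and r_pos: "\<And>N T. r N T > 0"
    and meas: "\<And>N T. phihat N T \<in> borel_measurable M"
      "\<And>N T. zAD N T \<in> borel_measurable M" "\<And>N T. zJK N T \<in> borel_measurable M"
    (* Assumption AD *)
    and AD_exp: "op1 M (\<lambda>k x. r (NN k) (TT k) * (phihat (NN k) (TT k) x $ i0 - \<phi>)
                    - zAD (NN k) (TT k) x - (\<Sum>j\<in>UNIV. \<mu> (NN k) (TT k) $ j))"
    and AD_var: "0 < \<sigma>2"
    and AD_clt: "weak_conv_m (\<lambda>k. distr M borel (zAD (NN k) (TT k)))
                   (density lborel (normal_density 0 (sqrt \<sigma>2)))"
    (* Assumption JK *)
    and JK_m: "CARD('m) \<ge> CARD('r) + 2"
    and JK_exp: "op1 M (\<lambda>k x. r (NN k) (TT k) *\<^sub>R (phihat (NN k) (TT k) x - \<phi> *\<^sub>R (\<chi> i. 1))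
                    - zJK (NN k) (TT k) x - A *v \<mu> (NN k) (TT k))"
    and JK_L: "mvn_law (\<sigma>2 *\<^sub>R C) L"
    and JK_clt: "conv_distr M (\<lambda>k. zJK (NN k) (TT k)) L"
    and A_rank: "rank A = CARD('r)"
    and iota_col: "(\<chi> i. 1) \<notin> range (\<lambda>y. A *v y)"
    and null_cond: "\<not> {v. v v* A = 0 \<and> v \<bullet> (\<chi> i. 1) = 0} \<subseteq> {v. C *v v = 0}"
    and C_sym: "transpose C = C" and C_psd: "\<And>x. x \<bullet> (C *v x) \<ge> 0"
    (* the theorem's hypotheses *)
    and V_null: "{v. v v* A = 0 \<and> v \<bullet> (\<chi> i. 1) = 1} \<inter> {v. C *v v = 0} = {}"
    and vs_V: "vs v* A = 0" "vs \<bullet> (\<chi> i. 1) = 1"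
    and vs_min: "\<And>w. w v* A = 0 \<Longrightarrow> w \<bullet> (\<chi> i. 1) = 1 \<Longrightarrow> vs \<bullet> (C *v vs) \<le> w \<bullet> (C *v w)"
    and U_A: "transpose U ** A = 0"
    and U_iota: "transpose U *v (\<chi> i. 1) = 0"
    and U_C: "transpose U ** C ** U = mat (vs \<bullet> (C *v vs))"
  shows "weak_conv_m
           (\<lambda>k. distr M borel (\<lambda>x.
              let phit = vs \<bullet> phihat (NN k) (TT k) x;
                  sig2 = (1 / real CARD('q)) * (\<Sum>l\<in>UNIV. (column l U \<bullet> phihat (NN k) (TT k) x)\<^sup>2)
              in (phit - \<phi>) / sqrt sig2))
           (student_t CARD('q))"
proof -
  interpret prob_space M by (rule M)
  have L: "prob_space L" "sets L = sets borel" using JK_L by (auto simp: mvn_law_def)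

  let ?u = "\<lambda>l. column l U"
  define c where "c = vs \<bullet> (C *v vs)"
  define Y where "Y k x = r (NN k) (TT k) *\<^sub>R (phihat (NN k) (TT k) x - \<phi> *\<^sub>R (\<chi> i. 1)) - A *v \<mu> (NN k) (TT k)" for k x
  define g where "g y = (vs \<bullet> y) / sqrt ((1 / real CARD('q)) * (\<Sum>l\<in>UNIV. (?u l \<bullet> y)\<^sup>2))" for y
  have g_meas [measurable]: "g \<in> borel_measurable borel" unfolding g_def by measurable
  have [measurable]: "Y k \<in> borel_measurable M" for k
    unfolding Y_def using meas(1) by measurable
  have u_A: "?u l v* A = 0" for l
  proof -
    have "(?u l v* A) $ j = (transpose U ** A) $ l $ j" for j
      by (simp add: vector_matrix_mult_def matrix_matrix_mult_def transpose_def column_def mult.commute)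
    then show ?thesis by (simp add: U_A vec_eq_iff)
  qed
  have u_iota: "?u l \<bullet> (\<chi> i. 1) = 0" for l
  proof -
    have "?u l \<bullet> (\<chi> i. 1) = (transpose U *v (\<chi> i. 1)) $ l"
      by (simp add: inner_vec_def matrix_vector_mult_def transpose_def column_def)
    then show ?thesis unfolding U_iota by simp
  qed
  have u_C: "?u k \<bullet> (C *v ?u l) = (if k = l then c else 0)" for k l
  proof -
    have "?u k \<bullet> (C *v ?u l) = (transpose U ** C ** U) $ k $ l"
      unfolding matrix_mul_assoc[symmetric]
      by (simp add: inner_vec_def matrix_matrix_mult_def matrix_vector_mult_def transpose_def column_def)
    then show ?thesis by (simp add: U_C mat_def c_def)
  qed
  \<comment> \<open>\<open>vs\<close> lies in \<V>, so \<open>C\<close> does not annihilate it; for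
    a semidefinite form this already excludes the value 0.\<close>
  have c: "c > 0"
  proof -
    have "C *v vs \<noteq> 0" using V_null vs_V by auto
    then have "c \<noteq> 0" unfolding c_def using psd_quadratic_form_zero_imp_null[OF C_sym C_psd] by blast
    then show ?thesis using C_psd[of vs] by (simp add: c_def)
  qed
  \<comment> \<open>Moving from \<open>vs\<close> along a column of \<open>U\<close> preserves both
    constraints, so minimality makes the increment a nonnegative quadratic in
    \<open>t\<close>.\<close>
  have uv: "?u l \<bullet> (C *v vs) = 0" for l
  proof (rule quadratic_nonneg_imp_linear_coeff_zero)
    fix t
    have "(vs + t *\<^sub>R ?u l) v* A = 0"
      using vs_V(1) u_A by (simp add: vector_matrix_left_distrib scaleR_vector_matrix_assoc)
    moreover have "(vs + t *\<^sub>R ?u l) \<bullet> (\<chi> i. 1) = 1"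
      using vs_V(2) u_iota by (simp add: inner_add_left)
    ultimately have "vs \<bullet> (C *v vs) \<le> (vs + t *\<^sub>R ?u l) \<bullet> (C *v (vs + t *\<^sub>R ?u l))"
      by (rule vs_min)
    then show "0 \<le> 2 * t * (?u l \<bullet> (C *v vs)) + t\<^sup>2 * (?u l \<bullet> (C *v ?u l))"
      unfolding symmetric_quadratic_form_add_scaleR[OF C_sym] by simp
  qed (rule C_psd)
  have vu: "vs \<bullet> (C *v ?u l) = 0" for l
    using uv symmetric_matrix_inner_commute[OF C_sym] by metis
  have S: "x \<bullet> ((\<sigma>2 *\<^sub>R C) *v y) = \<sigma>2 * (x \<bullet> (C *v y))" for x y
    by (simp add: scaleR_matrix_vector_assoc[symmetric])
  have ratio: "distr L borel g = student_t CARD('q)" "AE y in L. (\<Sum>l\<in>UNIV. (?u l \<bullet> y)\<^sup>2) \<noteq> 0"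
    unfolding g_def
    by (rule mvn_law_ratio_student_t[OF JK_L, of "\<sigma>2 * c" vs ?u];
        use c AD_var u_C uv vu in \<open>simp add: S c_def\<close>)+
  \<comment> \<open>The scale \<open>\<rho>\<close> cancels because it is positive; since division
    by zero yields 0 on both sides, the identity also holds where the denominator vanishes.\<close>
  have stat: "(let phit = vs \<bullet> phihat (NN k) (TT k) x;
        sig2 = (1 / real CARD('q)) * (\<Sum>l\<in>UNIV. (?u l \<bullet> phihat (NN k) (TT k) x)\<^sup>2)
      in (phit - \<phi>) / sqrt sig2) = g (Y k x)" for k x
  proof -
    define \<rho> where "\<rho> = r (NN k) (TT k)"
    have \<rho>: "\<rho> > 0" using r_pos by (simp add: \<rho>_def)
    have 1: "vs \<bullet> Y k x = \<rho> * (vs \<bullet> phihat (NN k) (TT k) x - \<phi>)"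
      using vs_V dot_lmul_matrix[of vs A] by (simp add: Y_def \<rho>_def inner_diff_right)
    have 2: "?u l \<bullet> Y k x = \<rho> * (?u l \<bullet> phihat (NN k) (TT k) x)" for l
      using u_A[of l] u_iota[of l] dot_lmul_matrix[of "?u l" A] by (simp add: Y_def \<rho>_def inner_diff_right)
    have "(\<Sum>l\<in>UNIV. (?u l \<bullet> Y k x)\<^sup>2) = \<rho>\<^sup>2 * (\<Sum>l\<in>UNIV. (?u l \<bullet> phihat (NN k) (TT k) x)\<^sup>2)"
      by (simp add: 2 power_mult_distrib sum_distrib_left)
    then have "g (Y k x) = \<rho> * (vs \<bullet> phihat (NN k) (TT k) x - \<phi>)
        / (\<rho> * sqrt ((1 / real CARD('q)) * (\<Sum>l\<in>UNIV. (?u l \<bullet> phihat (NN k) (TT k) x)\<^sup>2)))"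
      using \<rho> by (simp add: g_def 1 real_sqrt_mult real_sqrt_divide)
    then show ?thesis using \<rho> by (simp add: Let_def)
  qed
  \<comment> \<open>Continuous ramps \<open>cts_step a b\<close> are enough test functions for weak
    convergence on the real line.\<close>
  have lim: "(\<lambda>k. \<integral>x. cts_step a b (g (Y k x)) \<partial>M) \<longlonglongrightarrow> (\<integral>y. cts_step a b (g y) \<partial>L)" if "a < b" for a b
  proof (rule conv_distr_integral_mapping[OF L JK_clt, where G = "\<lambda>y. \<Sum>l\<in>UNIV. (?u l \<bullet> y)\<^sup>2" and B = 1])
    have step: "continuous_on UNIV (cts_step a b)"
      using cts_step_uniformly_continuous[OF that] by (rule uniformly_continuous_imp_continuous)
    then have [measurable]: "cts_step a b \<in> borel_measurable borel"
      by (rule borel_measurable_continuous_onI)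
    show "(\<lambda>y. cts_step a b (g y)) \<in> borel_measurable borel" by measurable
    show "op1 M (\<lambda>k x. Y k x - zJK (NN k) (TT k) x)"
      using JK_exp by (simp add: Y_def algebra_simps)
    show "\<bar>cts_step a b (g y)\<bar> \<le> 1" for y
      using that by (auto simp: cts_step_def field_simps)
    show "isCont (\<lambda>y. cts_step a b (g y)) y" if "(\<Sum>l\<in>UNIV. (?u l \<bullet> y)\<^sup>2) \<noteq> 0" for y
    proof -
      have "isCont g y" unfolding g_def using that by (intro continuous_intros) auto
      moreover have "isCont (cts_step a b) (g y)"
        using step by (simp add: continuous_on_eq_continuous_at)
      ultimately show ?thesis by (rule isCont_o2)
    qed
  qed (use meas ratio(2) in \<open>auto intro!: continuous_intros\<close>)
  interpret L: prob_space L by (rule L)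
  note L(2)[measurable_cong]
  have "weak_conv_m (\<lambda>k. distr M borel (\<lambda>x. g (Y k x))) (distr L borel g)"
  proof (rule integral_cts_step_conv_imp_weak_conv)
    fix a b :: real assume "a < b"
    then have [measurable]: "cts_step a b \<in> borel_measurable borel"
      by (intro borel_measurable_continuous_onI uniformly_continuous_imp_continuous cts_step_uniformly_continuous)
    show "(\<lambda>k. integral\<^sup>L (distr M borel (\<lambda>x. g (Y k x))) (cts_step a b)) \<longlonglongrightarrow> integral\<^sup>L (distr L borel g) (cts_step a b)"
      using lim[OF \<open>a < b\<close>] by (simp add: integral_distr)
  qed (auto intro!: real_distribution_distr L.real_distribution_distr)
  then show ?thesis unfolding stat ratio(1) .
qed

end
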